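(* Let $1\leq t\leq 4$, let $G$ be a planar graph with maximum degree $\Delta\geq 28-t$, and let $H$ be a subgraph of $G$ that is a set of distance-3 cliques. Then any total-$(\Delta+t)$-coloring of $H$ can be extended to a total-$(\Delta+t)$-coloring of $G$.
   Context: All graphs are simple. A total-$k$-coloring of a graph is an assignment of colors from $\{1,\dots,k\}$ to its vertices and edges such that adjacent vertices receive different colors, edges sharing an endpoint receive different colors, and no edge receives the same color as either of its endpoints. A subgraph $H$ of $G$ is a set of distance-3 cliques if $H$ is a disjoint union of vertex-disjoint cliques (possibly of different sizes) and any two vertices in distinct components of $H$ are at distance at least $3$ in $G$. Extending a total coloring $\varphi$ of $H$ to $G$ means finding a total-$k$-coloring of $G$ agreeing with $\varphi$ on all vertices and edges of $H$. *)

theory Defs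
  imports "HOL-Analysis.Analysis"
begin

definition simple_graph :: "'a set \<Rightarrow> 'a set set \<Rightarrow> bool" where
  "simple_graph V E \<longleftrightarrow> finite V \<and>
     (\<forall>e\<in>E. \<exists>u v. e = {u, v} \<and> u \<noteq> v \<and> u \<in> V \<and> v \<in> V)"

definition degree :: "'a set set \<Rightarrow> 'a \<Rightarrow> nat" where
  "degree E v = card {e\<in>E. v \<in> e}"

definition max_degree :: "'a set \<Rightarrow> 'a set set \<Rightarrow> nat" where
  "max_degree V E = Max (degree E ` V)"

definition planar_graph :: "'a set \<Rightarrow> 'a set set \<Rightarrow> bool" where
  "planar_graph V E \<longleftrightarrow> simple_graph V E \<and>
     (\<exists>(p :: 'a \<Rightarrow> real^2) (\<gamma> :: 'a set \<Rightarrow> real \<Rightarrow> real^2).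
        inj_on p V \<and>
        (\<forall>e\<in>E. arc (\<gamma> e) \<and> {pathstart (\<gamma> e), pathfinish (\<gamma> e)} = p ` e \<and>
                 path_image (\<gamma> e) \<inter> p ` V = p ` e) \<and>
        (\<forall>e\<in>E. \<forall>e'\<in>E. e \<noteq> e' \<longrightarrow>
                 path_image (\<gamma> e) \<inter> path_image (\<gamma> e') \<subseteq> p ` (e \<inter> e')))"

definition subgraph :: "'a set \<Rightarrow> 'a set set \<Rightarrow> 'a set \<Rightarrow> 'a set set \<Rightarrow> bool" where
  "subgraph VH EH V E \<longleftrightarrow> VH \<subseteq> V \<and> EH \<subseteq> E \<and> (\<forall>e\<in>EH. e \<subseteq> VH)"

text \<open>H = (VH, EH) is a set of distance-3 cliques in G = (V, E): H is a disjoint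
  union of cliques (adjacency in H plus equality is transitive), and any two
  vertices in distinct components of H (i.e. distinct and non-adjacent in H)
  are at distance at least 3 in G (not adjacent and no common neighbour).\<close>
definition distance3_cliques :: "'a set \<Rightarrow> 'a set set \<Rightarrow> 'a set \<Rightarrow> 'a set set \<Rightarrow> bool" where
  "distance3_cliques VH EH V E \<longleftrightarrow>
     (\<forall>u\<in>VH. \<forall>v\<in>VH. \<forall>w\<in>VH. {u, v} \<in> EH \<and> {v, w} \<in> EH \<and> u \<noteq> w \<longrightarrow> {u, w} \<in> EH) \<and>
     (\<forall>u\<in>VH. \<forall>v\<in>VH. u \<noteq> v \<and> {u, v} \<notin> EH \<longrightarrow>
        {u, v} \<notin> E \<and> \<not> (\<exists>w. {u, w} \<in> E \<and> {w, v} \<in> E))"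

definition total_coloring ::
  "'a set \<Rightarrow> 'a set set \<Rightarrow> nat \<Rightarrow> ('a \<Rightarrow> nat) \<Rightarrow> ('a set \<Rightarrow> nat) \<Rightarrow> bool" where
  "total_coloring V E k cv ce \<longleftrightarrow>
     (\<forall>v\<in>V. cv v \<in> {1..k}) \<and> (\<forall>e\<in>E. ce e \<in> {1..k}) \<and>
     (\<forall>u v. {u, v} \<in> E \<longrightarrow> cv u \<noteq> cv v) \<and>
     (\<forall>e\<in>E. \<forall>e'\<in>E. e \<noteq> e' \<and> e \<inter> e' \<noteq> {} \<longrightarrow> ce e \<noteq> ce e') \<and>
     (\<forall>e\<in>E. \<forall>v\<in>e. ce e \<noteq> cv v)"

end

theory Submission
  imports Defs
begin

text \<open>
  A planar graph satisfies \<open>|E| < 3|V|\<close>, and so does each of its subgraphs. To see this, call a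
  drawing weak if independent edges are represented by disjoint connected sets; weak drawings
  survive contraction of edges. \<open>K\<^sub>5\<close> has no weak drawing, since the continuous logarithms of
  \<open>\<gamma>\<^sub>c\<^sub>d(t) - \<gamma>\<^sub>a\<^sub>b(s)\<close> would give integers violating a parity count, and Mader's argument turns the
  absence of \<open>K\<^sub>5\<close> minors into the edge bound.

  For the colouring let \<open>k = \<Delta> + t\<close> and consider a minimal counterexample. An edge \<open>uv\<close> with
  \<open>u \<notin> H\<close> and \<open>d(u) \<le> 13\<close> satisfies \<open>d(u) + d(v) \<ge> k\<close>. For \<open>i \<le> 5\<close>, let \<open>A\<^sub>i\<close> be the set of vertices
  outside \<open>H\<close> of degree at most \<open>i\<close>. By Galvin's list colouring argument for bipartite graphs,
  every nonempty subset \<open>S\<close> of \<open>A\<^sub>i\<close> has a neighbour with fewer than \<open>i\<close> neighbours in \<open>S\<close>, so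
  \<open>|A\<^sub>i| \<le> (i - 1)|B|\<close>, where \<open>B\<close> consists of the neighbours of \<open>A\<^sub>5\<close>, all of degree at least \<open>23\<close>.
  Remove the vertices of \<open>H\<close> of degree at most \<open>12\<close>; each vertex loses at most \<open>6\<close> neighbours. In
  the remaining graph only \<open>A\<^sub>5\<close> has vertices of degree below \<open>6\<close>, its total deficit is at most
  \<open>|A\<^sub>1| + ... + |A\<^sub>5| \<le> 10|B|\<close>, and every vertex of \<open>B\<close> has excess at least \<open>10\<close>. So the average
  degree is at least \<open>6\<close>, a contradiction.
\<close>

section \<open>Weak drawings\<close>

text \<open>The difference f - g is continuous and takes values among the logarithms of \<kappa>,
  which lie at least 2\<pi> apart, so it is constant. The factor \<kappa> lets logarithms of a
  function and of its negative be compared.\<close>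

lemma log_increment_unique:
  fixes f g :: "real \<Rightarrow> complex"
  assumes "continuous_on {0..1} f" "continuous_on {0..1} g"
    and eq: "\<And>t. t \<in> {0..1} \<Longrightarrow> exp (f t) = \<kappa> * exp (g t)"
  shows "f 1 - f 0 = g 1 - g 0"
proof -
  define h where "h t = f t - g t" for t
  have cont: "continuous_on {0..1} h"
    unfolding h_def by (intro continuous_intros assms)
  have exph: "exp (h t) = \<kappa>" if "t \<in> {0..1}" for t
    using eq[OF that] by (simp add: h_def exp_diff)
  have "h constant_on {0..1}"
  proof (rule continuous_discrete_range_constant[OF _ cont])
    show "connected {0..1::real}" by simp
    fix x :: real assume x: "x \<in> {0..1}"
    show "\<exists>e>0. \<forall>y. y \<in> {0..1} \<and> h y \<noteq> h x \<longrightarrow> e \<le> cmod (h y - h x)"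
    proof (intro exI conjI allI impI)
      show "(0::real) < 2 * pi" by simp
      fix y assume y: "y \<in> {0..1} \<and> h y \<noteq> h x"
      then have "exp (h y) = exp (h x)" using exph x by simp
      then obtain n :: int where n: "h y = h x + of_int (2 * n) * pi * \<i>"
        unfolding exp_eq by auto
      then have "n \<noteq> 0" using y by auto
      then have "1 \<le> \<bar>real_of_int n\<bar>" by linarith
      moreover have "cmod (h y - h x) = 2 * pi * \<bar>real_of_int n\<bar>"
        using n by (simp add: norm_mult)
      ultimately show "2 * pi \<le> cmod (h y - h x)" by simp
    qed
  qed
  then have "h 1 = h 0" unfolding constant_on_def by force
  then show ?thesis by (simp add: h_def algebra_simps)
qed

text \<open>The boundary of the unit square, mapped by \<open>(s, t) \<mapsto> h t - g s\<close>, winds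
  zero times around the origin.\<close>
lemma log_increment_square:
  fixes g h l0 l1 m0 m1 :: "real \<Rightarrow> complex"
  assumes "path g" "path h" "path_image g \<inter> path_image h = {}"
    and "continuous_on {0..1} l0" "\<And>s. s \<in> {0..1} \<Longrightarrow> exp (l0 s) = g s - h 0"
    and "continuous_on {0..1} l1" "\<And>s. s \<in> {0..1} \<Longrightarrow> exp (l1 s) = g s - h 1"
    and "continuous_on {0..1} m0" "\<And>s. s \<in> {0..1} \<Longrightarrow> exp (m0 s) = h s - g 0"
    and "continuous_on {0..1} m1" "\<And>s. s \<in> {0..1} \<Longrightarrow> exp (m1 s) = h s - g 1"
  shows "(l0 1 - l0 0) + (m1 1 - m1 0) = (m0 1 - m0 0) + (l1 1 - l1 0)"
proof -
  let ?S = "{0..1} \<times> {0..1} :: (real \<times> real) set"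
  have "continuous_on ?S (\<lambda>x. h (snd x) - g (fst x))"
    using assms(1,2) unfolding path_def
    by (intro continuous_on_diff
        continuous_on_compose2[OF _ continuous_on_snd[OF continuous_on_id], of _ h]
        continuous_on_compose2[OF _ continuous_on_fst[OF continuous_on_id], of _ g]) auto
  moreover have "contractible ?S"
    by (intro convex_imp_contractible convex_Times) auto
  moreover have "h (snd x) - g (fst x) \<noteq> 0" if "x \<in> ?S" for x
    using that assms(3) unfolding path_image_def by fastforce
  ultimately obtain L where cL: "continuous_on ?S L"
    and L: "\<And>x. x \<in> ?S \<Longrightarrow> h (snd x) - g (fst x) = exp (L x)"
    by (rule continuous_logarithm_on_contractible) auto
  have ch: "continuous_on {0..1} (\<lambda>s. L (s, c))" "continuous_on {0..1} (\<lambda>s. L (c, s))"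
    if "c \<in> {0..1}" for c
    using that by (auto intro!: continuous_on_compose2[OF cL] continuous_intros)
  \<comment> \<open>\<open>L\<close> is a logarithm of h(t) - g(s). On the two sides with t fixed,
    \<open>l0\<close> and \<open>l1\<close> belong to the negative of that function, hence \<kappa>
    = -1; on the other two sides the functions agree. Both sides of the claim are then L(1,1) -
    L(0,0), read along the two boundary routes.\<close>
  have e1: "L (1, 0) - L (0, 0) = l0 1 - l0 0"
    using L[symmetric] assms(5)
    by (intro log_increment_unique[where \<kappa> = "-1"] ch assms) auto
  have e2: "L (1, 1) - L (0, 1) = l1 1 - l1 0"
    using L[symmetric] assms(7)
    by (intro log_increment_unique[where \<kappa> = "-1"] ch assms) auto
  have e3: "L (0, 1) - L (0, 0) = m0 1 - m0 0"
    using L[symmetric] assms(9)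
    by (intro log_increment_unique[where \<kappa> = 1] ch assms) auto
  have e4: "L (1, 1) - L (1, 0) = m1 1 - m1 0"
    using L[symmetric] assms(11)
    by (intro log_increment_unique[where \<kappa> = 1] ch assms) auto
  show ?thesis unfolding e1[symmetric] e2[symmetric] e3[symmetric] e4[symmetric] by simp
qed

text \<open>The logarithmic increment \<open>\<theta> c a b\<close> of the path \<open>ab\<close> seen from the vertex \<open>c\<close> differs from the
  straight-line value by \<open>2\<pi>i\<close> times an integer \<open>n c a b\<close>. For each four vertices the sum of the twelve
  integers is odd (only the crossing pairing \<open>ac|bd\<close> contributes), but over all five choices of
  four vertices every integer occurs exactly twice.\<close>
lemma no_K5_with_disjoint_independent_paths:
  fixes P :: "nat \<Rightarrow> complex" and g :: "nat \<Rightarrow> nat \<Rightarrow> real \<Rightarrow> complex"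
  assumes path: "\<And>a b. a < b \<Longrightarrow> b < 5 \<Longrightarrow>
      path (g a b) \<and> pathstart (g a b) = P a \<and> pathfinish (g a b) = P b"
    and disj: "\<And>a b c d. a < b \<Longrightarrow> b < 5 \<Longrightarrow> c < d \<Longrightarrow> d < 5 \<Longrightarrow> {a, b} \<inter> {c, d} = {} \<Longrightarrow>
      path_image (g a b) \<inter> path_image (g c d) = {}"
  shows False
proof -
  have g0: "g a b 0 = P a" and g1: "g a b 1 = P b" if "a < b" "b < 5" for a b
    using path[OF that] by (auto simp: pathstart_def pathfinish_def)
  have P_in: "P a \<in> path_image (g a b)" "P b \<in> path_image (g a b)" if "a < b" "b < 5" for a b
    using path[OF that] by (metis pathstart_in_path_image pathfinish_in_path_image)+
  have fresh: "\<exists>d<5. d \<notin> {a, b, c}" for a b c :: nat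
  proof -
    have "card {a, b, c} < card {..<5::nat}"
      by (rule le_less_trans[of _ 3]) (auto simp: card_insert_if)
    then have "\<not> {..<5} \<subseteq> {a, b, c}"
      by (metis card_mono finite.emptyI finite.insertI not_le)
    then show ?thesis by blast
  qed
  \<comment> \<open>With five vertices there is always a further vertex d, and the edge cd through
    \<open>P c\<close> is independent of ab.\<close>
  have off: "P c \<notin> path_image (g a b)" if "a < b" "b < 5" "c < 5" "c \<notin> {a, b}" for a b c
  proof -
    obtain d where d: "d < 5" "d \<notin> {a, b, c}" using fresh by blast
    then consider "c < d" | "d < c" by fastforce
    then show ?thesis
    proof cases
      case 1
      then have "path_image (g a b) \<inter> path_image (g c d) = {}"
        using that d by (intro disj) auto
      then show ?thesis using P_in[OF 1] d by blast
    next
      case 2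
      then have "path_image (g a b) \<inter> path_image (g d c) = {}"
        using that d by (intro disj) auto
      then show ?thesis using P_in[OF 2] that by blast
    qed
  qed
  have P_neq: "P x \<noteq> P y" if "x < 5" "y < 5" "x \<noteq> y" for x y
  proof -
    obtain b where b: "b < 5" "b \<notin> {x, y, y}" using fresh by blast
    then consider "x < b" | "b < x" by fastforce
    then show ?thesis
      using P_in[of x b] off[of x b y] P_in[of b x] off[of b x y] that b by cases auto
  qed
  have "\<exists>l. continuous_on {0..1} l \<and> (\<forall>s\<in>{0..1}. exp (l s) = g a b s - P c)"
    if "a < b" "b < 5" "c < 5" "c \<notin> {a, b}" for a b c
  proof -
    have "continuous_on {0..1} (\<lambda>s. g a b s - P c)"
      using path[OF that(1,2)] unfolding path_def by (intro continuous_intros) auto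
    moreover have "contractible {0..1::real}"
      by (intro convex_imp_contractible) auto
    moreover have "g a b s - P c \<noteq> 0" if s: "s \<in> {0..1}" for s
      using s off[OF \<open>a < b\<close> \<open>b < 5\<close> \<open>c < 5\<close> \<open>c \<notin> {a, b}\<close>] unfolding path_image_def by (metis eq_iff_diff_eq_0 imageI)
    ultimately obtain l where "continuous_on {0..1} l" "\<And>s. s \<in> {0..1} \<Longrightarrow> g a b s - P c = exp (l s)"
      by (rule continuous_logarithm_on_contractible) auto
    then show ?thesis by metis
  qed
  then have "\<forall>c a b. \<exists>l. a < b \<longrightarrow> b < 5 \<longrightarrow> c < 5 \<longrightarrow> c \<notin> {a, b} \<longrightarrow>
      continuous_on {0..1} l \<and> (\<forall>s\<in>{0..1}. exp (l s) = g a b s - P c)"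
    by blast
  then obtain l where l': "\<forall>c a b. a < b \<longrightarrow> b < 5 \<longrightarrow> c < 5 \<longrightarrow> c \<notin> {a, b} \<longrightarrow>
      continuous_on {0..1} (l c a b) \<and> (\<forall>s\<in>{0..1}. exp (l c a b s) = g a b s - P c)"
    unfolding choice_iff by blast
  have cl: "continuous_on {0..1} (l c a b)"
    and l: "\<And>s. s \<in> {0..1} \<Longrightarrow> exp (l c a b s) = g a b s - P c"
    if "a < b" "b < 5" "c < 5" "c \<notin> {a, b}" for a b c
    using l' that by blast+
  define \<theta> where "\<theta> c a b = l c a b 1 - l c a b 0" for c a b
  have square: "\<theta> c a b + \<theta> b c d = \<theta> a c d + \<theta> d a b"
    if "a < b" "b < 5" "c < d" "d < 5" "{a, b} \<inter> {c, d} = {}" for a b c d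
    unfolding \<theta>_def
    by (rule log_increment_square[of "g a b" "g c d"])
      (use that path disj[OF that] cl l g0 g1 in auto)
  \<comment> \<open>A logarithm of P y - P x whose branch is chosen so that reversing x < y adds
    exactly i\<pi>. This makes the straight-line values comparable and leaves only integers.\<close>
  define lg where "lg x y = (if x < y then Ln (P y - P x) else Ln (P x - P y) + \<i> * pi)" for x y
  have exp_lg: "exp (lg x y) = P y - P x" if "x < 5" "y < 5" "x \<noteq> y" for x y
    using P_neq[OF that] by (auto simp: lg_def exp_add)
  have "\<exists>n::int. \<theta> c a b = lg c b - lg c a + of_int (2 * n) * pi * \<i>"
    if "a < b" "b < 5" "c < 5" "c \<notin> {a, b}" for a b c
  proof -
    have "exp (\<theta> c a b) = (P b - P c) / (P a - P c)"
      unfolding \<theta>_def exp_diff using l[OF that] g0[OF that(1,2)] g1[OF that(1,2)] by simp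
    also have "\<dots> = exp (lg c b - lg c a)"
      unfolding exp_diff using exp_lg that by simp
    finally show ?thesis unfolding exp_eq .
  qed
  then have "\<forall>c a b. \<exists>n::int. a < b \<longrightarrow> b < 5 \<longrightarrow> c < 5 \<longrightarrow> c \<notin> {a, b} \<longrightarrow>
      \<theta> c a b = lg c b - lg c a + of_int (2 * n) * pi * \<i>"
    by blast
  then obtain n :: "nat \<Rightarrow> nat \<Rightarrow> nat \<Rightarrow> int" where n': "\<forall>c a b. a < b \<longrightarrow> b < 5 \<longrightarrow> c < 5 \<longrightarrow> c \<notin> {a, b} \<longrightarrow>
      \<theta> c a b = lg c b - lg c a + of_int (2 * n c a b) * pi * \<i>"
    unfolding choice_iff by blast
  have n: "\<theta> c a b = lg c b - lg c a + of_int (2 * n c a b) * pi * \<i>"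
    if "a < b" "b < 5" "c < 5" "c \<notin> {a, b}" for a b c
    using n' that by blast
  have lg_flip: "lg y x = lg x y + \<i> * pi" if "x < y" for x y
    using that by (simp add: lg_def)
  have cancel: "i = j" if "(of_int (2 * i) :: complex) * pi * \<i> = of_int (2 * j) * pi * \<i>" for i j :: int
    using that by simp
  \<comment> \<open>The \<open>lg\<close> terms of \<open>square\<close> cancel up to half turns
    from \<open>lg_flip\<close>. For the separated and the nested pairing these half turns cancel as
    well; for the crossing pairing they add up to one full turn, which is the 1 in
    \<open>cross\<close>.\<close>
  have sep: "n c a b + n b c d = n a c d + n d a b"
    if "a < b" "b < c" "c < d" "d < 5" for a b c d
  proof (rule cancel)
    show "(of_int (2 * (n c a b + n b c d)) :: complex) * pi * \<i> = of_int (2 * (n a c d + n d a b)) * pi * \<i>"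
      using square[of a b c d] n[of a b c] n[of a b d] n[of c d a] n[of c d b] that
        lg_flip[of a c] lg_flip[of a d] lg_flip[of b c] lg_flip[of b d]
      by (simp add: algebra_simps)
  qed
  have nest: "n b a d + n d b c = n a b c + n c a d"
    if "a < b" "b < c" "c < d" "d < 5" for a b c d
  proof (rule cancel)
    show "(of_int (2 * (n b a d + n d b c)) :: complex) * pi * \<i> = of_int (2 * (n a b c + n c a d)) * pi * \<i>"
      using square[of a d b c] n[of a d b] n[of a d c] n[of b c a] n[of b c d] that
        lg_flip[of a c] lg_flip[of a b] lg_flip[of b d] lg_flip[of c d]
      by (simp add: algebra_simps)
  qed
  have cross: "n b a c + n c b d = n a b d + n d a c + 1"
    if "a < b" "b < c" "c < d" "d < 5" for a b c d
  proof (rule cancel)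
    show "(of_int (2 * (n b a c + n c b d)) :: complex) * pi * \<i>
        = of_int (2 * (n a b d + n d a c + 1)) * pi * \<i>"
      using square[of a c b d] n[of a c b] n[of a c d] n[of b d a] n[of b d c] that
        lg_flip[of a b] lg_flip[of a d] lg_flip[of b c] lg_flip[of c d]
      by (simp add: algebra_simps)
  qed
  define T where "T a b c d = n c a b + n d a b + n b a c + n d a c + n b a d + n c a d
     + n a b c + n d b c + n a b d + n c b d + n a c d + n b c d" for a b c d
  have "odd (T a b c d)" if "a < b" "b < c" "c < d" "d < 5" for a b c d
  proof -
    have "T a b c d = (n c a b + n b c d) + (n b a d + n d b c) + (n b a c + n c b d)
        + (n a c d + n d a b) + (n a b c + n c a d) + (n a b d + n d a c)"
      unfolding T_def by simp
    also have "\<dots> = 2 * (n a c d + n d a b + n a b c + n c a d + n a b d + n d a c) + 1"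
      unfolding sep[OF that] nest[OF that] cross[OF that] by simp
    finally show ?thesis by simp
  qed
  then have "odd (T 0 1 2 3 + T 0 1 2 4 + T 0 1 3 4 + T 0 2 3 4 + T 1 2 3 4)"
    by simp
  \<comment> \<open>Each integer involves three vertices, and a triple lies in exactly two of the
    five quadruples.\<close>
  moreover have "T 0 1 2 3 + T 0 1 2 4 + T 0 1 3 4 + T 0 2 3 4 + T 1 2 3 4 = 2 *
    (n 2 0 1 + n 3 0 1 + n 4 0 1 + n 1 0 2 + n 3 0 2 + n 4 0 2 + n 1 0 3 + n 2 0 3 + n 4 0 3
     + n 1 0 4 + n 2 0 4 + n 3 0 4 + n 0 1 2 + n 3 1 2 + n 4 1 2 + n 0 1 3 + n 2 1 3 + n 4 1 3
     + n 0 1 4 + n 2 1 4 + n 3 1 4 + n 0 2 3 + n 1 2 3 + n 4 2 3 + n 0 2 4 + n 1 2 4 + n 3 2 4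
     + n 0 3 4 + n 1 3 4 + n 2 3 4)"
    unfolding T_def by (simp add: algebra_simps)
  ultimately show False by (metis dvd_triv_left)
qed

section \<open>Weak drawings under restriction and contraction\<close>

text \<open>Adjacent edges may overlap, and an edge may pass through other vertices; this is what makes the
  notion stable under contraction.\<close>
definition weak_drawing :: "'a set set \<Rightarrow> ('a \<Rightarrow> complex) \<Rightarrow> ('a set \<Rightarrow> complex set) \<Rightarrow> bool" where
  "weak_drawing E p \<Gamma> \<longleftrightarrow> (\<forall>e\<in>E. path_connected (\<Gamma> e) \<and> p ` e \<subseteq> \<Gamma> e) \<and>
     (\<forall>e\<in>E. \<forall>f\<in>E. e \<inter> f = {} \<longrightarrow> \<Gamma> e \<inter> \<Gamma> f = {})"

text \<open>\<open>y\<close> is merged into \<open>x\<close>.\<close>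
definition contract :: "'a set set \<Rightarrow> 'a \<Rightarrow> 'a \<Rightarrow> 'a set set" where
  "contract E x y = {e\<in>E. y \<notin> e} \<union> (\<lambda>z. {x, z}) ` ({z. {y, z} \<in> E} - {x})"

lemma weak_drawingD:
  assumes "weak_drawing E p \<Gamma>"
  shows "e \<in> E \<Longrightarrow> path_connected (\<Gamma> e)" "e \<in> E \<Longrightarrow> p ` e \<subseteq> \<Gamma> e"
    and "e \<in> E \<Longrightarrow> f \<in> E \<Longrightarrow> e \<inter> f = {} \<Longrightarrow> \<Gamma> e \<inter> \<Gamma> f = {}"
  using assms unfolding weak_drawing_def by simp_all

lemma weak_drawing_subset:
  assumes "weak_drawing E p \<Gamma>" "E' \<subseteq> E"
  shows "weak_drawing E' p \<Gamma>"
  unfolding weak_drawing_def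
  by (intro conjI ballI impI weak_drawingD[OF assms(1)] subsetD[OF assms(2)])

text \<open>Number the five vertices by an injection \<open>h\<close> and choose a path inside each
  path-connected set. Injectivity turns disjoint index pairs into independent edges, so the chosen
  paths are disjoint where \<open>no_K5_with_disjoint_independent_paths\<close> requires it.\<close>

lemma weak_drawing_no_K5:
  assumes wd: "weak_drawing E p \<Gamma>" and X: "card X = 5"
    and adj: "\<And>u v. u \<in> X \<Longrightarrow> v \<in> X \<Longrightarrow> u \<noteq> v \<Longrightarrow> {u, v} \<in> E"
  shows False
proof -
  have "finite X" using X card.infinite by fastforce
  then obtain h where "bij_betw h {0..<card X} X" using ex_bij_betw_nat_finite by blast
  then have h: "inj_on h {0..<5}" "\<And>i. i < 5 \<Longrightarrow> h i \<in> X"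
    by (auto simp: bij_betw_def X)
  have hE: "{h a, h b} \<in> E" if "a < b" "b < 5" for a b
  proof (rule adj)
    show "h a \<in> X" "h b \<in> X" using that h(2) by auto
    show "h a \<noteq> h b" using that inj_onD[OF h(1), of a b] by auto
  qed
  have "\<forall>a b. \<exists>g. a < b \<longrightarrow> b < 5 \<longrightarrow>
    path g \<and> path_image g \<subseteq> \<Gamma> {h a, h b} \<and> pathstart g = p (h a) \<and> pathfinish g = p (h b)"
  proof (intro allI)
    fix a b
    show "\<exists>g. a < b \<longrightarrow> b < 5 \<longrightarrow>
      path g \<and> path_image g \<subseteq> \<Gamma> {h a, h b} \<and> pathstart g = p (h a) \<and> pathfinish g = p (h b)"
    proof (cases "a < b \<and> b < 5")
      case True
      then have "path_connected (\<Gamma> {h a, h b})" "p (h a) \<in> \<Gamma> {h a, h b}" "p (h b) \<in> \<Gamma> {h a, h b}"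
        using wd hE[of a b] unfolding weak_drawing_def by auto
      then show ?thesis unfolding path_connected_def by blast
    qed auto
  qed
  then obtain g where g: "\<forall>a b. a < b \<longrightarrow> b < 5 \<longrightarrow> path (g a b) \<and> path_image (g a b) \<subseteq> \<Gamma> {h a, h b} \<and>
      pathstart (g a b) = p (h a) \<and> pathfinish (g a b) = p (h b)"
    unfolding choice_iff by (elim exE) (rule that)
  show False
  proof (rule no_K5_with_disjoint_independent_paths[of g "p \<circ> h"])
    fix a b :: nat assume "a < b" "b < 5"
    then show "path (g a b) \<and> pathstart (g a b) = (p \<circ> h) a \<and> pathfinish (g a b) = (p \<circ> h) b"
      using g by simp
  next
    fix a b c d :: nat assume ab: "a < b" "b < 5" and cd: "c < d" "d < 5" and disj: "{a, b} \<inter> {c, d} = {}"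
    have "h ` {a, b} \<inter> h ` {c, d} = h ` ({a, b} \<inter> {c, d})"
      using ab cd by (intro inj_on_image_Int[OF h(1), symmetric]) auto
    then have "{h a, h b} \<inter> {h c, h d} = {}" unfolding disj by simp
    then have "\<Gamma> {h a, h b} \<inter> \<Gamma> {h c, h d} = {}"
      by (rule weak_drawingD(3)[OF wd hE[OF ab] hE[OF cd]])
    moreover have "path_image (g a b) \<subseteq> \<Gamma> {h a, h b}" "path_image (g c d) \<subseteq> \<Gamma> {h c, h d}"
      using g ab cd by auto
    ultimately show "path_image (g a b) \<inter> path_image (g c d) = {}" by blast
  qed
qed

text \<open>A new edge xz is drawn as the union of the sets of xy and yz, which meet in
  \<open>p y\<close>. Two new edges share x, and an old edge that avoids y and is disjoint from {x,
  z} is disjoint from both xy and yz.\<close>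

lemma weak_drawing_contract:
  assumes wd: "weak_drawing E p \<Gamma>" and xy: "{x, y} \<in> E" and irr: "\<And>v. {v} \<notin> E"
  shows "\<exists>\<Gamma>'. weak_drawing (contract E x y) p \<Gamma>'"
proof -
  have pc: "\<And>e. e \<in> E \<Longrightarrow> path_connected (\<Gamma> e)" and pe: "\<And>e. e \<in> E \<Longrightarrow> p ` e \<subseteq> \<Gamma> e"
    and dj: "\<And>e f. e \<in> E \<Longrightarrow> f \<in> E \<Longrightarrow> e \<inter> f = {} \<Longrightarrow> \<Gamma> e \<inter> \<Gamma> f = {}"
    using weak_drawingD[OF wd] by simp_all
  \<comment> \<open>For a new edge e = {x, z} the set \<open>insert y (e - {x})\<close> recovers the
    old edge {y, z}; an edge that was already present keeps its old set.\<close>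
  define \<Gamma>' where "\<Gamma>' e = (if e \<in> E \<and> y \<notin> e then \<Gamma> e else \<Gamma> {x, y} \<union> \<Gamma> (insert y (e - {x})))" for e
  have old_or_new: "e \<in> E \<and> y \<notin> e \<and> \<Gamma>' e = \<Gamma> e \<or>
      (\<exists>z. e = {x, z} \<and> z \<noteq> x \<and> z \<noteq> y \<and> {y, z} \<in> E \<and> \<Gamma>' e = \<Gamma> {x, y} \<union> \<Gamma> {y, z})"
    if "e \<in> contract E x y" for e
  proof (cases "e \<in> E \<and> y \<notin> e")
    case True
    then show ?thesis by (simp add: \<Gamma>'_def)
  next
    case False
    then obtain z where z: "e = {x, z}" "z \<noteq> x" "{y, z} \<in> E"
      using \<open>e \<in> contract E x y\<close> unfolding contract_def by blast
    moreover have "z \<noteq> y" using irr[of y] z by auto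
    moreover have "insert y (e - {x}) = {y, z}" using z by auto
    ultimately show ?thesis using False unfolding \<Gamma>'_def by auto
  qed
  have "weak_drawing (contract E x y) p \<Gamma>'"
    unfolding weak_drawing_def
  proof (intro conjI ballI impI)
    fix e assume e: "e \<in> contract E x y"
    from old_or_new[OF e] show "path_connected (\<Gamma>' e)"
    proof (elim disjE exE conjE)
      fix z assume z: "{y, z} \<in> E" "\<Gamma>' e = \<Gamma> {x, y} \<union> \<Gamma> {y, z}"
      have "p y \<in> \<Gamma> {x, y} \<inter> \<Gamma> {y, z}" using pe[OF xy] pe[OF z(1)] by auto
      then show ?thesis unfolding z(2) using pc xy z(1) by (intro path_connected_Un) auto
    qed (simp add: pc)
    from old_or_new[OF e] show "p ` e \<subseteq> \<Gamma>' e"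
    proof (elim disjE exE conjE)
      fix z assume "e = {x, z}" "{y, z} \<in> E" "\<Gamma>' e = \<Gamma> {x, y} \<union> \<Gamma> {y, z}"
      then show ?thesis using pe[OF xy] pe[of "{y, z}"] by auto
    qed (simp add: pe)
  next
    fix e f assume e: "e \<in> contract E x y" and f: "f \<in> contract E x y" and ef: "e \<inter> f = {}"
    from old_or_new[OF e] old_or_new[OF f] show "\<Gamma>' e \<inter> \<Gamma>' f = {}"
    proof (elim disjE exE conjE)
      assume "e \<in> E" "f \<in> E" "\<Gamma>' e = \<Gamma> e" "\<Gamma>' f = \<Gamma> f"
      then show ?thesis using dj ef by simp
    next
      fix z assume z: "e \<in> E" "y \<notin> e" "\<Gamma>' e = \<Gamma> e" "f = {x, z}" "{y, z} \<in> E" "\<Gamma>' f = \<Gamma> {x, y} \<union> \<Gamma> {y, z}"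
      then have "\<Gamma> e \<inter> \<Gamma> {x, y} = {}" "\<Gamma> e \<inter> \<Gamma> {y, z} = {}" using dj xy ef by auto
      then show ?thesis using z by auto
    next
      fix z assume z: "f \<in> E" "y \<notin> f" "\<Gamma>' f = \<Gamma> f" "e = {x, z}" "{y, z} \<in> E" "\<Gamma>' e = \<Gamma> {x, y} \<union> \<Gamma> {y, z}"
      then have "\<Gamma> f \<inter> \<Gamma> {x, y} = {}" "\<Gamma> f \<inter> \<Gamma> {y, z} = {}" using dj xy ef by auto
      then show ?thesis using z by auto
    next
      fix z z' assume "e = {x, z}" "f = {x, z'}"
      then show ?thesis using ef by simp
    qed
  qed
  then show ?thesis by blast
qed

section \<open>Simple graphs: edges, degrees, planar drawings, contraction\<close>

lemma simple_graph_finite: "simple_graph V E \<Longrightarrow> finite V"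
  by (simp add: simple_graph_def)

lemma simple_graphE:
  assumes "simple_graph V E" "e \<in> E"
  obtains u v where "e = {u, v}" "u \<noteq> v" "u \<in> V" "v \<in> V"
proof -
  have "\<exists>u v. e = {u, v} \<and> u \<noteq> v \<and> u \<in> V \<and> v \<in> V"
    using assms by (simp add: simple_graph_def)
  then show thesis by (elim exE conjE) (rule that)
qed

lemma simple_graph_edge_mem:
  assumes "simple_graph V E" "{u, v} \<in> E"
  shows "u \<in> V \<and> v \<in> V \<and> u \<noteq> v"
proof -
  obtain a b where "{u, v} = {a, b}" "a \<noteq> b" "a \<in> V" "b \<in> V"
    using assms by (rule simple_graphE)
  then show ?thesis by (auto simp: doubleton_eq_iff)
qed

lemma simple_graph_irrefl: "simple_graph V E \<Longrightarrow> {v} \<notin> E"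
  using simple_graph_edge_mem[of V E v v] by auto

lemma simple_graph_edgeE:
  assumes "simple_graph V E" "e \<in> E" "v \<in> e"
  obtains u where "e = {v, u}"
proof -
  obtain a b where e: "e = {a, b}" using assms(1,2) by (rule simple_graphE)
  with assms(3) have "v = a \<or> v = b" by simp
  then have "\<exists>u. e = {v, u}" unfolding e by (metis insert_commute)
  then show thesis by (elim exE) (rule that)
qed

lemma simple_graph_edge_subset: "simple_graph V E \<Longrightarrow> e \<in> E \<Longrightarrow> e \<subseteq> V"
  by (erule (1) simple_graphE) simp

lemma simple_graph_finite_edges: "simple_graph V E \<Longrightarrow> finite E"
  by (rule finite_subset[of _ "Pow V"]) (auto dest: simple_graph_edge_subset simple_graph_finite)

lemma simple_graph_restrict:
  assumes "simple_graph V E" "V' \<subseteq> V" "E' \<subseteq> E" "\<And>e. e \<in> E' \<Longrightarrow> e \<subseteq> V'"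
  shows "simple_graph V' E'"
  unfolding simple_graph_def
proof (intro conjI ballI)
  show "finite V'" using assms(2) simple_graph_finite[OF assms(1)] by (rule finite_subset)
  fix e assume e: "e \<in> E'"
  then have "e \<in> E" using assms(3) by blast
  with assms(1) obtain u v where "e = {u, v}" "u \<noteq> v" by (rule simple_graphE)
  then show "\<exists>u v. e = {u, v} \<and> u \<noteq> v \<and> u \<in> V' \<and> v \<in> V'" using assms(4)[OF e] by auto
qed

lemma simple_graph_card_edge: "simple_graph V E \<Longrightarrow> e \<in> E \<Longrightarrow> card e = 2"
  by (erule (1) simple_graphE) simp

text \<open>The plane is identified with the complex numbers, where logarithms are available.
  Independent edges are nonempty, hence distinct, so their arcs can meet only in the image of the
  empty set.\<close>

lemma planar_graph_weak_drawing:
  assumes "planar_graph V E"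
  shows "\<exists>p \<Gamma>. weak_drawing E p \<Gamma>"
proof -
  have E: "simple_graph V E" using assms by (simp add: planar_graph_def)
  obtain p :: "'a \<Rightarrow> real^2" and \<gamma> where
    arc: "\<forall>e\<in>E. arc (\<gamma> e) \<and> {pathstart (\<gamma> e), pathfinish (\<gamma> e)} = p ` e \<and>
      path_image (\<gamma> e) \<inter> p ` V = p ` e"
    and disj: "\<forall>e\<in>E. \<forall>e'\<in>E. e \<noteq> e' \<longrightarrow>
      path_image (\<gamma> e) \<inter> path_image (\<gamma> e') \<subseteq> p ` (e \<inter> e')"
    using assms unfolding planar_graph_def by (elim exE conjE) (rule that)
  define f :: "real^2 \<Rightarrow> complex" where "f x = Complex (x $ 1) (x $ 2)" for x
  have cont: "continuous_on S f" for S
    unfolding f_def Complex_eq by (intro continuous_intros)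
  have inj: "f x = f y \<Longrightarrow> x = y" for x y
    by (simp add: f_def vec_eq_iff forall_2)
  have "weak_drawing E (f \<circ> p) (\<lambda>e. f ` path_image (\<gamma> e))"
    unfolding weak_drawing_def
  proof (intro conjI ballI impI)
    fix e assume e: "e \<in> E"
    show "path_connected (f ` path_image (\<gamma> e))"
      using arc e by (intro path_connected_continuous_image cont path_connected_path_image arc_imp_path) simp
    have "p ` e \<subseteq> path_image (\<gamma> e)"
      using arc e by blast
    then show "(f \<circ> p) ` e \<subseteq> f ` path_image (\<gamma> e)" by auto
  next
    fix e e' assume ee: "e \<in> E" "e' \<in> E" "e \<inter> e' = {}"
    have "e \<noteq> {}" using simple_graph_card_edge[OF E ee(1)] by auto
    then have "e \<noteq> e'" using ee by blast
    then have "path_image (\<gamma> e) \<inter> path_image (\<gamma> e') = {}"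
      using disj ee by fastforce
    then show "f ` path_image (\<gamma> e) \<inter> f ` path_image (\<gamma> e') = {}"
      using inj by blast
  qed
  then show ?thesis by blast
qed

lemma simple_graph_degree:
  assumes "simple_graph V E"
  shows "degree E v = card {u. {v, u} \<in> E}"
proof -
  have "{e\<in>E. v \<in> e} = (\<lambda>u. {v, u}) ` {u. {v, u} \<in> E}"
    using assms by (auto elim!: simple_graph_edgeE)
  moreover have "inj_on (\<lambda>u. {v, u}) {u. {v, u} \<in> E}"
    by (auto simp: inj_on_def doubleton_eq_iff)
  ultimately show ?thesis unfolding degree_def by (simp add: card_image)
qed

lemma simple_graph_finite_nbrs:
  "simple_graph V E \<Longrightarrow> finite {u. {v, u} \<in> E}"
  by (rule finite_subset[of _ V]) (auto dest: simple_graph_edge_mem simple_graph_finite)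

lemma sum_degree:
  assumes "simple_graph V E"
  shows "(\<Sum>v\<in>V. degree E v) = 2 * card E"
proof -
  have "finite V" "finite E" by (rule simple_graph_finite[OF assms], rule simple_graph_finite_edges[OF assms])
  have "(\<Sum>v\<in>V. degree E v) = (\<Sum>v\<in>V. \<Sum>e\<in>E. if v \<in> e then 1 else 0)"
    unfolding degree_def using \<open>finite E\<close> by (simp add: sum.If_cases Int_def)
  also have "\<dots> = (\<Sum>e\<in>E. \<Sum>v\<in>V. if v \<in> e then 1 else 0)" by (rule sum.swap)
  also have "\<dots> = (\<Sum>e\<in>E. card e)"
  proof (rule sum.cong[OF refl])
    fix e assume "e \<in> E"
    then have "V \<inter> {v. v \<in> e} = e" using simple_graph_edge_subset[OF assms] by blast
    then show "(\<Sum>v\<in>V. if v \<in> e then 1 else 0) = card e" using \<open>finite V\<close> by (simp add: sum.If_cases)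
  qed
  also have "\<dots> = 2 * card E" using simple_graph_card_edge[OF assms] by simp
  finally show ?thesis .
qed

lemma simple_graph_card_le_choose:
  assumes "simple_graph V E"
  shows "card E \<le> card V choose 2"
proof -
  have "finite V" by (rule simple_graph_finite[OF assms])
  moreover have "E \<subseteq> {e. e \<subseteq> V \<and> card e = 2}"
    using simple_graph_card_edge[OF assms] simple_graph_edge_subset[OF assms] by blast
  ultimately have "card E \<le> card {e. e \<subseteq> V \<and> card e = 2}"
    by (intro card_mono) auto
  then show ?thesis using n_subsets[OF \<open>finite V\<close>] by simp
qed

lemma simple_graph_contract:
  assumes "simple_graph V E" "{x, y} \<in> E"
  shows "simple_graph (V - {y}) (contract E x y)"
  unfolding simple_graph_def
proof (intro conjI ballI)
  show "finite (V - {y})" using simple_graph_finite[OF assms(1)] by simp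
  fix e assume "e \<in> contract E x y"
  then consider "e \<in> E" "y \<notin> e" | z where "e = {x, z}" "{y, z} \<in> E" "z \<noteq> x"
    unfolding contract_def by blast
  then show "\<exists>u v. e = {u, v} \<and> u \<noteq> v \<and> u \<in> V - {y} \<and> v \<in> V - {y}"
  proof cases
    case 1
    from assms(1) this(1) obtain u v where "e = {u, v}" "u \<noteq> v" "u \<in> V" "v \<in> V"
      by (rule simple_graphE)
    then show ?thesis using 1(2) by blast
  next
    case 2
    then show ?thesis
      using simple_graph_edge_mem[OF assms] simple_graph_edge_mem[OF assms(1) 2(2)] by blast
  qed
qed

text \<open>Contraction loses the edge xy itself and, for every common neighbour z, one of the two
  merged edges xz and yz.\<close>

lemma card_contract:
  assumes E: "simple_graph V E" and xy: "{x, y} \<in> E"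
  shows "card E \<le> card (contract E x y) + 1 + card {z. {x, z} \<in> E \<and> {y, z} \<in> E}"
proof -
  have fin: "finite E" and fN: "finite {u. {v, u} \<in> E}" for v
    using simple_graph_finite_edges[OF E] simple_graph_finite_nbrs[OF E] by auto
  let ?N = "{z. {y, z} \<in> E}" and ?C = "{z. {x, z} \<in> E \<and> {y, z} \<in> E}"
  let ?O = "{e\<in>E. y \<notin> e}" and ?W = "(\<lambda>z. {x, z}) ` (?N - {x} - ?C)"
  have finC: "finite ?C" using fN[of x] by (rule rev_finite_subset) auto
  have x: "x \<in> ?N" using xy by (simp add: insert_commute)
  have "x \<notin> ?C" using simple_graph_irrefl[OF E] by auto
  have "card ?W = card (?N - {x} - ?C)" by (rule card_image) (auto simp: inj_on_def doubleton_eq_iff)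
  moreover have "card (?N - {x} - ?C) = card (?N - insert x ?C)" by (rule arg_cong[where f = card]) blast
  moreover have "card (?N - insert x ?C) = card ?N - card (insert x ?C)"
    using x finC by (intro card_Diff_subset) auto
  ultimately have W: "card ?N \<le> card ?W + 1 + card ?C"
    using card_insert_disjoint[OF finC \<open>x \<notin> ?C\<close>] by linarith
  have "card E = card ?O + degree E y"
    unfolding degree_def using fin by (subst card_Un_disjoint[symmetric]) (auto intro: arg_cong[where f = card])
  then have "card E = card ?O + card ?N" unfolding simple_graph_degree[OF E] .
  moreover have "card ?O + card ?W = card (?O \<union> ?W)"
    using fin fN by (intro card_Un_disjoint[symmetric]) auto
  moreover have "card (?O \<union> ?W) \<le> card (contract E x y)"
    using fin fN unfolding contract_def by (intro card_mono) auto
  ultimately show ?thesis using W by linarith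
qed

section \<open>The edge bound for weakly drawable and planar graphs\<close>

text \<open>Mader's argument: in a minimal counterexample contracting an edge loses at least four edges,
  so a vertex of degree at most five has a neighbourhood in which every vertex misses at most one
  other. Hence there is a \<open>K\<^sub>5\<close>, possibly after contracting one more edge.\<close>
lemma weak_drawing_card_edges:
  assumes "simple_graph V E" "weak_drawing E p \<Gamma>" "3 \<le> card V"
  shows "card E + 6 \<le> 3 * card V"
  using assms
proof (induction "card V" arbitrary: V E \<Gamma> rule: less_induct)
  case less
  show ?case
  proof (rule ccontr)
    assume "\<not> card E + 6 \<le> 3 * card V"
    then have "3 * card V - 5 \<le> card E" by linarith
    \<comment> \<open>Exactly one edge above the bound. For 3 or 4 vertices this is 4 or 7 edges,
      more than the 3 or 6 possible ones.\<close>
    then obtain D where D: "D \<subseteq> E" "card D = 3 * card V - 5"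
      by (rule obtain_subset_with_card_n)
    have sD: "simple_graph V D"
      using simple_graph_edge_subset[OF less.prems(1)] D(1)
      by (intro simple_graph_restrict[OF less.prems(1)]) auto
    have wD: "weak_drawing D p \<Gamma>" by (rule weak_drawing_subset[OF less.prems(2) D(1)])
    have fV: "finite V" by (rule simple_graph_finite[OF sD])
    have "card V \<noteq> 3" "card V \<noteq> 4"
      using simple_graph_card_le_choose[OF sD] D(2) by (auto simp: choose_two)
    then have n5: "5 \<le> card V" using less.prems(3) by linarith
    have "\<exists>x\<in>V. degree D x \<le> 5"
    proof (rule ccontr)
      assume "\<not> (\<exists>x\<in>V. degree D x \<le> 5)"
      then have "of_nat (card V) * 6 \<le> (\<Sum>v\<in>V. degree D v)"
        by (intro sum_bounded_below) auto
      then show False using sum_degree[OF sD] D(2) n5 by simp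
    qed
    then obtain x where x: "x \<in> V" "degree D x \<le> 5" by blast
    define N where "N = {z. {x, z} \<in> D}"
    have degN: "degree D x = card N" unfolding N_def by (rule simple_graph_degree[OF sD])
    have finN: "finite N" unfolding N_def by (rule simple_graph_finite_nbrs[OF sD])
    have NI: "{x, z} \<in> D" "{z, x} \<in> D" "z \<noteq> x" if "z \<in> N" for z
      using that simple_graph_edge_mem[OF sD, of x z] unfolding N_def by (auto simp: insert_commute)
    \<comment> \<open>On one vertex fewer, at most 3(n - 1) - 6 = 3n - 9 edges remain, four fewer
      than \<open>D\<close> has. Deleting \<open>x\<close> therefore shows degree at least 4, and
      contracting an edge at \<open>x\<close> shows at least three common neighbours.\<close>
    have bound: "card D' + 9 \<le> 3 * card V"
      if "y \<in> V" "simple_graph (V - {y}) D'" "weak_drawing D' p \<Gamma>'" for y D' \<Gamma>'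
    proof -
      have "card (V - {y}) = card V - 1" using that(1) by simp
      moreover from this have "card D' + 6 \<le> 3 * card (V - {y})"
        using n5 by (intro less.hyps[OF _ that(2,3)]) auto
      ultimately show ?thesis using n5 by linarith
    qed
    have n4: "4 \<le> card N"
    proof (rule ccontr)
      assume "\<not> 4 \<le> card N"
      let ?D' = "{e\<in>D. x \<notin> e}"
      have "card ?D' + 9 \<le> 3 * card V"
      proof (rule bound[OF x(1)])
        show "simple_graph (V - {x}) ?D'"
          using simple_graph_edge_subset[OF sD] by (intro simple_graph_restrict[OF sD]) auto
        show "weak_drawing ?D' p \<Gamma>" by (rule weak_drawing_subset[OF wD]) auto
      qed
      moreover have "card D = card ?D' + degree D x"
        unfolding degree_def using simple_graph_finite_edges[OF sD]
        by (subst card_Un_disjoint[symmetric]) (auto intro: arg_cong[where f = card])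
      ultimately show False using \<open>\<not> 4 \<le> card N\<close> degN D(2) n5 by linarith
    qed
    have contracted: "\<exists>\<Gamma>'. weak_drawing (contract D u v) p \<Gamma>'" if "{u, v} \<in> D" for u v
      by (rule weak_drawing_contract[OF wD that simple_graph_irrefl[OF sD]])
    \<comment> \<open>Besides y itself, at least three members of \<open>N\<close> are adjacent to
      y.\<close>
    have missing: "card {z\<in>N. z \<noteq> y \<and> {y, z} \<notin> D} + 4 \<le> card N" if y: "y \<in> N" for y
    proof -
      let ?C = "{z. {x, z} \<in> D \<and> {y, z} \<in> D}"
      have "y \<in> V" using simple_graph_edge_mem[OF sD NI(1)[OF y]] by blast
      moreover have "simple_graph (V - {y}) (contract D x y)"
        by (rule simple_graph_contract[OF sD NI(1)[OF y]])
      moreover obtain \<Gamma>' where "weak_drawing (contract D x y) p \<Gamma>'"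
        using contracted[OF NI(1)[OF y]] by (elim exE) (rule that)
      ultimately have "card (contract D x y) + 9 \<le> 3 * card V" by (rule bound)
      then have C3: "3 \<le> card ?C"
        using card_contract[OF sD NI(1)[OF y]] D(2) n5 by linarith
      have CN: "?C \<subseteq> N" unfolding N_def by auto
      have finC: "finite ?C" using CN finN by (rule finite_subset)
      have yC: "y \<notin> ?C" using simple_graph_irrefl[OF sD, of y] by auto
      have "card {z\<in>N. z \<noteq> y \<and> {y, z} \<notin> D} = card (N - insert y ?C)"
        unfolding N_def by (rule arg_cong[where f = card]) auto
      moreover have "card (N - insert y ?C) = card N - card (insert y ?C)"
        using finC CN y by (intro card_Diff_subset) auto
      moreover have "card (insert y ?C) \<le> card N" using CN y finN by (intro card_mono) auto
      ultimately show ?thesis using card_insert_disjoint[OF finC yC] C3 by linarith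
    qed
    have no_clique: False if W: "W \<subseteq> N" "card W = 4"
      and adj: "\<And>u v. u \<in> W \<Longrightarrow> v \<in> W \<Longrightarrow> u \<noteq> v \<Longrightarrow> {u, v} \<in> D" for W
    proof (rule weak_drawing_no_K5[OF wD])
      have "x \<notin> W" using NI W(1) by blast
      moreover have "finite W" using W(1) finN by (rule finite_subset)
      ultimately show "card (insert x W) = 5" using W(2) by simp
      fix u v assume "u \<in> insert x W" "v \<in> insert x W" "u \<noteq> v"
      then show "{u, v} \<in> D" using adj NI W(1) by blast
    qed
    show False
    proof (cases "card N = 4")
      case True
      have "{u, v} \<in> D" if "u \<in> N" "v \<in> N" "u \<noteq> v" for u v
      proof -
        have "card {z\<in>N. z \<noteq> u \<and> {u, z} \<notin> D} = 0" using missing[OF that(1)] True by linarith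
        then have "{z\<in>N. z \<noteq> u \<and> {u, z} \<notin> D} = {}" using finN by simp
        then show ?thesis using that by blast
      qed
      then show False using no_clique[OF subset_refl True] by blast
    next
      case False
      then have N5: "card N = 5" using n4 degN x(2) by linarith
      \<comment> \<open>The non-adjacent pairs inside \<open>N\<close> are pairwise disjoint.
        Without a 4-clique there are at least two, ab and cd, and five vertices leave no room for a
        third.\<close>
      have uniq: "z = z'" if "y \<in> N" "z \<in> N" "z' \<in> N" "z \<noteq> y" "z' \<noteq> y" "{y, z} \<notin> D" "{y, z'} \<notin> D" for y z z'
      proof -
        have "card {z\<in>N. z \<noteq> y \<and> {y, z} \<notin> D} \<le> Suc 0" using missing[OF that(1)] N5 by linarith
        then show ?thesis using that finN card_le_Suc0_iff_eq[of "{z\<in>N. z \<noteq> y \<and> {y, z} \<notin> D}"] by auto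
      qed
      obtain W0 where W0: "W0 \<subseteq> N" "card W0 = 4"
        using obtain_subset_with_card_n[of 4 N] N5 by (metis n4)
      obtain a b where ab: "a \<in> N" "b \<in> N" "a \<noteq> b" "{a, b} \<notin> D"
        using no_clique[OF W0] W0(1) by blast
      have "card (N - {a}) = 4" using ab(1) N5 by simp
      then obtain c d where cd: "c \<in> N - {a}" "d \<in> N - {a}" "c \<noteq> d" "{c, d} \<notin> D"
        using no_clique[of "N - {a}"] by blast
      have ba: "{b, a} \<notin> D" using ab(4) by (simp add: insert_commute)
      have dc: "{d, c} \<notin> D" using cd(4) by (simp add: insert_commute)
      have bc: "b \<noteq> c" using uniq[of b a d] ab cd ba by blast
      have bd: "b \<noteq> d" using uniq[of b a c] ab cd ba dc by blast
      have adj: "{u, v} \<in> D" if "u \<in> N" "v \<in> N" "u \<noteq> v" "{u, v} \<noteq> {a, b}" "{u, v} \<noteq> {c, d}" for u v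
      proof (rule ccontr)
        assume uv: "{u, v} \<notin> D"
        then have vu: "{v, u} \<notin> D" by (simp add: insert_commute)
        have "u \<noteq> a" using uniq[of a b v] uv that ab by blast
        moreover have "u \<noteq> b" using uniq[of b a v] uv that ab ba by (auto simp: insert_commute)
        moreover have "u \<noteq> c" using uniq[of c d v] uv that cd by blast
        moreover have "u \<noteq> d" using uniq[of d c v] uv that cd dc by (auto simp: insert_commute)
        moreover have "v \<noteq> a" using uniq[of a b u] vu that ab by (auto simp: insert_commute)
        moreover have "v \<noteq> b" using uniq[of b a u] vu that ab ba by blast
        moreover have "v \<noteq> c" using uniq[of c d u] vu that cd by (auto simp: insert_commute)
        moreover have "v \<noteq> d" using uniq[of d c u] vu that cd dc by blast
        ultimately have "card {a, b, c, d, u, v} = 6" using ab(3) cd(1,2,3) bc bd that(3) by auto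
        moreover have "card {a, b, c, d, u, v} \<le> card N"
          using ab cd that finN by (intro card_mono) auto
        ultimately show False using N5 by linarith
      qed
      \<comment> \<open>Merging c into a repairs both gaps: the edge cb becomes ab, and the pair cd
        disappears with c. Together with \<open>x\<close>, the four remaining vertices of
        \<open>N\<close> form \<open>K\<^sub>5\<close>.\<close>
      have ac: "{a, c} \<in> D"
        using cd bc ab(3) by (intro adj ab) (auto simp: doubleton_eq_iff)
      obtain \<Gamma>' where w': "weak_drawing (contract D a c) p \<Gamma>'"
        using contracted[OF ac] by (elim exE) (rule that)
      have kept: "{u, v} \<in> contract D a c" if "{u, v} \<in> D" "u \<noteq> c" "v \<noteq> c" for u v
        using that unfolding contract_def by auto
      have new: "{a, b} \<in> contract D a c"
      proof -
        have "{c, b} \<in> D" using cd bc bd ab by (intro adj) (auto simp: doubleton_eq_iff)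
        then show ?thesis using ab(3) unfolding contract_def by auto
      qed
      show False
      proof (rule weak_drawing_no_K5[OF w'])
        have "card (insert x (N - {c})) = Suc (card (N - {c}))"
          using NI(3) finN by (intro card_insert_disjoint) auto
        then show "card (insert x (N - {c})) = 5" using cd(1) N5 by simp
        fix u v assume uv: "u \<in> insert x (N - {c})" "v \<in> insert x (N - {c})" "u \<noteq> v"
        have "c \<noteq> x" using NI(3) cd(1) by blast
        then have ne: "u \<noteq> c" "v \<noteq> c" using uv by auto
        show "{u, v} \<in> contract D a c"
        proof (cases "{u, v} = {a, b}")
          case True
          then show ?thesis using new by simp
        next
          case False
          have "{u, v} \<noteq> {c, d}" using ne by (auto simp: doubleton_eq_iff)
          then have "{u, v} \<in> D" using uv False adj[of u v] NI(1)[of v] NI(2)[of u] by auto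
          then show ?thesis by (rule kept[OF _ ne])
        qed
      qed
    qed
  qed
qed

text \<open>A weak drawing restricts to subgraphs. The bound 3n is weaker than 3n - 6 so that it
  also covers one or two vertices, where 3n - 6 fails.\<close>

lemma planar_graph_sparse:
  assumes "planar_graph V E" "V' \<subseteq> V" "E' \<subseteq> E" "\<And>e. e \<in> E' \<Longrightarrow> e \<subseteq> V'" "V' \<noteq> {}"
  shows "card E' < 3 * card V'"
proof -
  have E: "simple_graph V E" using assms(1) by (simp add: planar_graph_def)
  then have E': "simple_graph V' E'" by (rule simple_graph_restrict) (use assms in auto)
  have "card V' > 0" using assms(5) simple_graph_finite[OF E'] by (simp add: card_gt_0_iff)
  then consider "card V' = 1" | "card V' = 2" | "3 \<le> card V'" by linarith
  then show ?thesis
  proof cases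
    case 3
    obtain p \<Gamma> where "weak_drawing E p \<Gamma>"
      using planar_graph_weak_drawing[OF assms(1)] by (elim exE) (rule that)
    then have "card E' + 6 \<le> 3 * card V'"
      by (intro weak_drawing_card_edges[OF E' _ 3] weak_drawing_subset[OF _ assms(3)])
    then show ?thesis by linarith
  qed (use simple_graph_card_le_choose[OF E'] in \<open>auto simp: choose_two\<close>)
qed

section \<open>List edge colouring of bipartite graphs\<close>

text \<open>If the favourite edges of the left vertices are not already a matching, two of them
  collide at a right vertex and the one ranked lower there can be discarded.\<close>
lemma stable_matching_exists:
  fixes F :: "('a \<times> 'b) set" and ra rb :: "'a \<times> 'b \<Rightarrow> nat"
  assumes "finite F"
    and "\<And>e f. e \<in> F \<Longrightarrow> f \<in> F \<Longrightarrow> fst e = fst f \<Longrightarrow> ra e = ra f \<Longrightarrow> e = f"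
    and "\<And>e f. e \<in> F \<Longrightarrow> f \<in> F \<Longrightarrow> snd e = snd f \<Longrightarrow> rb e = rb f \<Longrightarrow> e = f"
  shows "\<exists>M\<subseteq>F. (\<forall>e\<in>M. \<forall>f\<in>M. e \<noteq> f \<longrightarrow> fst e \<noteq> fst f \<and> snd e \<noteq> snd f) \<and>
    (\<forall>e\<in>F - M. \<exists>f\<in>M. fst f = fst e \<and> ra f < ra e \<or> snd f = snd e \<and> rb f < rb e)"
  using assms
proof (induction "card F" arbitrary: F rule: less_induct)
  case (less F)
  define top where "top e \<longleftrightarrow> e \<in> F \<and> (\<forall>f\<in>F. fst f = fst e \<longrightarrow> ra e \<le> ra f)" for e
  have top_ex: "\<exists>f. top f \<and> fst f = fst e" if "e \<in> F" for e
  proof -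
    define m where "m = arg_min ra (\<lambda>f. f \<in> F \<and> fst f = fst e)"
    have "m \<in> F \<and> fst m = fst e"
      unfolding m_def by (rule arg_min_natI[of _ e]) (use that in auto)
    moreover have "ra m \<le> ra f" if "f \<in> F" "fst f = fst e" for f
      unfolding m_def by (rule arg_min_nat_le) (use that in auto)
    ultimately show ?thesis unfolding top_def by (metis)
  qed
  have top_unique: "e = f" if "top e" "top f" "fst e = fst f" for e f
    using that less.prems(2) unfolding top_def by (metis le_antisym)
  show ?case
  proof (cases "\<forall>e f. top e \<longrightarrow> top f \<longrightarrow> e \<noteq> f \<longrightarrow> snd e \<noteq> snd f")
    case True
    show ?thesis
    proof (intro exI[of _ "Collect top"] conjI ballI impI)
      show "Collect top \<subseteq> F" by (auto simp: top_def)
      fix e f assume "e \<in> Collect top" "f \<in> Collect top" "e \<noteq> f"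
      then show "fst e \<noteq> fst f" "snd e \<noteq> snd f" using True top_unique by blast+
    next
      fix e assume e: "e \<in> F - Collect top"
      then obtain f where "top f" "fst f = fst e" using top_ex by blast
      moreover have "ra f \<noteq> ra e"
        using less.prems(2)[of f e] e \<open>top f\<close> \<open>fst f = fst e\<close> unfolding top_def by auto
      ultimately show "\<exists>f\<in>Collect top. fst f = fst e \<and> ra f < ra e \<or> snd f = snd e \<and> rb f < rb e"
        using e unfolding top_def by (intro bexI[of _ f]) auto
    qed
  next
    case False
    then obtain e f where ef: "top e" "top f" "e \<noteq> f" "snd e = snd f" by blast
    have "\<exists>e f. top e \<and> f \<in> F \<and> e \<noteq> f \<and> snd e = snd f \<and> rb e < rb f"
    proof (cases "rb e < rb f")
      case True
      then show ?thesis using ef unfolding top_def by blast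
    next
      case False
      then have "rb f < rb e"
        using ef less.prems(3)[of e f] unfolding top_def by fastforce
      then show ?thesis using ef unfolding top_def by (metis)
    qed
    then obtain e f where ef: "top e" "f \<in> F" "e \<noteq> f" "snd e = snd f" "rb e < rb f" by blast
    have "card (F - {f}) < card F" using ef less.prems(1) by (intro psubset_card_mono) auto
    from less.hyps[OF this]
    have "\<exists>M\<subseteq>F - {f}. (\<forall>e\<in>M. \<forall>f\<in>M. e \<noteq> f \<longrightarrow> fst e \<noteq> fst f \<and> snd e \<noteq> snd f) \<and>
      (\<forall>e\<in>F - {f} - M. \<exists>f\<in>M. fst f = fst e \<and> ra f < ra e \<or> snd f = snd e \<and> rb f < rb e)"
      using less.prems(1) by (simp add: less.prems(2,3))
    then obtain M where M: "M \<subseteq> F - {f}"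
      "\<forall>e\<in>M. \<forall>f\<in>M. e \<noteq> f \<longrightarrow> fst e \<noteq> fst f \<and> snd e \<noteq> snd f"
      and dom: "\<forall>e\<in>F - {f} - M. \<exists>f\<in>M. fst f = fst e \<and> ra f < ra e \<or> snd f = snd e \<and> rb f < rb e"
      by (elim exE conjE) (rule that)
    \<comment> \<open>The discarded \<open>f\<close> is dominated as well. Either \<open>e\<close>
      is in \<open>M\<close>, or \<open>e\<close> is dominated by some h; as \<open>e\<close> is a
      favourite on the left, h beats it at the right vertex and so beats \<open>f\<close> there
      too.\<close>
    have "\<exists>h\<in>M. snd h = snd f \<and> rb h < rb f"
    proof (cases "e \<in> M")
      case False
      then have "e \<in> F - {f} - M" using ef(1,3) unfolding top_def by blast
      then obtain h where "h \<in> M" "fst h = fst e \<and> ra h < ra e \<or> snd h = snd e \<and> rb h < rb e"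
        using dom by blast
      moreover have "\<not> ra h < ra e" if "fst h = fst e"
        using ef(1) \<open>h \<in> M\<close> M(1) that unfolding top_def by (metis Diff_iff not_le subsetD)
      ultimately show ?thesis using ef(4,5) by (metis order.strict_trans)
    qed (use ef in blast)
    then have "\<forall>e\<in>F - M. \<exists>f\<in>M. fst f = fst e \<and> ra f < ra e \<or> snd f = snd e \<and> rb f < rb e"
      using dom by (metis Diff_iff singletonD)
    then show ?thesis using M by (intro exI[of _ M] conjI) auto
  qed
qed

text \<open>Galvin's argument: give one colour to a stable matching of the edges that may
  receive it; each remaining such edge loses one colour but also one preferred edge.\<close>
lemma list_edge_coloring_of_preferences:
  fixes F :: "('a \<times> 'b) set" and ra rb :: "'a \<times> 'b \<Rightarrow> nat" and L :: "'a \<times> 'b \<Rightarrow> 'c set"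
  assumes "finite F"
    and "\<And>e f. e \<in> F \<Longrightarrow> f \<in> F \<Longrightarrow> fst e = fst f \<Longrightarrow> ra e = ra f \<Longrightarrow> e = f"
    and "\<And>e f. e \<in> F \<Longrightarrow> f \<in> F \<Longrightarrow> snd e = snd f \<Longrightarrow> rb e = rb f \<Longrightarrow> e = f"
    and "\<And>e. e \<in> F \<Longrightarrow> finite (L e)"
    and "\<And>e. e \<in> F \<Longrightarrow> card {f\<in>F. fst f = fst e \<and> ra f < ra e}
                      + card {f\<in>F. snd f = snd e \<and> rb f < rb e} < card (L e)"
  shows "\<exists>c. (\<forall>e\<in>F. c e \<in> L e) \<and>
    (\<forall>e\<in>F. \<forall>f\<in>F. e \<noteq> f \<longrightarrow> fst e = fst f \<or> snd e = snd f \<longrightarrow> c e \<noteq> c f)"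
  using assms
proof (induction "card F" arbitrary: F L rule: less_induct)
  case (less F L)
  show ?case
  proof (cases "F = {}")
    case False
    then obtain e0 where e0: "e0 \<in> F" by blast
    then have "L e0 \<noteq> {}" using less.prems(5)[OF e0] by auto
    \<comment> \<open>Taking the colour from an actual list makes \<open>Fx\<close>, and hence
      \<open>M\<close>, nonempty, so the remaining edge set shrinks.\<close>
    then obtain x where x: "x \<in> L e0" by blast
    define Fx where "Fx = {e\<in>F. x \<in> L e}"
    have "finite Fx" using less.prems(1) by (simp add: Fx_def)
    from stable_matching_exists[OF this, of ra rb]
    have "\<exists>M\<subseteq>Fx. (\<forall>e\<in>M. \<forall>f\<in>M. e \<noteq> f \<longrightarrow> fst e \<noteq> fst f \<and> snd e \<noteq> snd f) \<and>
      (\<forall>e\<in>Fx - M. \<exists>f\<in>M. fst f = fst e \<and> ra f < ra e \<or> snd f = snd e \<and> rb f < rb e)"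
      unfolding Fx_def by (simp add: less.prems(2,3))
    then obtain M where M: "M \<subseteq> Fx"
      "\<forall>e\<in>M. \<forall>f\<in>M. e \<noteq> f \<longrightarrow> fst e \<noteq> fst f \<and> snd e \<noteq> snd f"
      and dom: "\<forall>e\<in>Fx - M. \<exists>f\<in>M. fst f = fst e \<and> ra f < ra e \<or> snd f = snd e \<and> rb f < rb e"
      by (elim exE conjE) (rule that)
    have "e0 \<in> Fx" using e0 x by (simp add: Fx_def)
    then have "M \<noteq> {}" using dom by blast
    define F' where "F' = F - M"
    have MF: "M \<subseteq> F" using M(1) by (auto simp: Fx_def)
    have F'F: "F' \<subseteq> F" "finite F'" using less.prems(1) by (auto simp: F'_def)
    have smaller: "card F' < card F"
      using MF \<open>M \<noteq> {}\<close> less.prems(1) unfolding F'_def by (intro psubset_card_mono) auto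
    have fewer: "card {f\<in>F'. fst f = fst e \<and> ra f < ra e} + card {f\<in>F'. snd f = snd e \<and> rb f < rb e}
        < card (L e - {x})" if e: "e \<in> F'" for e
    proof -
      let ?A = "\<lambda>F. {f\<in>F. fst f = fst e \<and> ra f < ra e}" and ?B = "\<lambda>F. {f\<in>F. snd f = snd e \<and> rb f < rb e}"
      have fin: "finite (?A F)" "finite (?B F)" using less.prems(1) by auto
      have sub: "?A F' \<subseteq> ?A F" "?B F' \<subseteq> ?B F" using F'F by auto
      have le: "card (?A F') \<le> card (?A F)" "card (?B F') \<le> card (?B F)"
        by (rule card_mono[OF fin(1) sub(1)], rule card_mono[OF fin(2) sub(2)])
      have eF: "e \<in> F" using e F'F by blast
      have lt: "card (?A F) + card (?B F) < card (L e)" by (rule less.prems(5)[OF eF])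
      show ?thesis
      proof (cases "x \<in> L e")
        case True
        then have "e \<in> Fx - M" using e by (auto simp: Fx_def F'_def)
        then obtain f where f: "f \<in> M" "fst f = fst e \<and> ra f < ra e \<or> snd f = snd e \<and> rb f < rb e"
          using dom by blast
        then have "f \<in> ?A F - ?A F' \<or> f \<in> ?B F - ?B F'" using MF by (auto simp: F'_def)
        then have "?A F' \<subset> ?A F \<or> ?B F' \<subset> ?B F" using sub by blast
        then have "card (?A F') < card (?A F) \<or> card (?B F') < card (?B F)"
          by (elim disj_forward psubset_card_mono[OF fin(1)] psubset_card_mono[OF fin(2)])
        moreover have "card (L e) = Suc (card (L e - {x}))"
          using card_Suc_Diff1[OF less.prems(4)[OF eF] True] by simp
        ultimately show ?thesis using le lt by linarith
      next
        case False
        then show ?thesis using le lt by simp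
      qed
    qed
    have "\<exists>c. (\<forall>e\<in>F'. c e \<in> L e - {x}) \<and>
      (\<forall>e\<in>F'. \<forall>f\<in>F'. e \<noteq> f \<longrightarrow> fst e = fst f \<or> snd e = snd f \<longrightarrow> c e \<noteq> c f)"
    proof (rule less.hyps[OF smaller F'F(2)])
      fix e assume e: "e \<in> F'"
      then have eF: "e \<in> F" using F'F(1) by blast
      show "finite (L e - {x})" using less.prems(4)[OF eF] by simp
      show "card {f\<in>F'. fst f = fst e \<and> ra f < ra e} + card {f\<in>F'. snd f = snd e \<and> rb f < rb e}
        < card (L e - {x})" by (rule fewer[OF e])
      fix f assume "f \<in> F'"
      then have fF: "f \<in> F" using F'F(1) by blast
      show "fst e = fst f \<Longrightarrow> ra e = ra f \<Longrightarrow> e = f" by (rule less.prems(2)[OF eF fF])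
      show "snd e = snd f \<Longrightarrow> rb e = rb f \<Longrightarrow> e = f" by (rule less.prems(3)[OF eF fF])
    qed
    then obtain c where c: "\<forall>e\<in>F'. c e \<in> L e - {x}"
      "\<forall>e\<in>F'. \<forall>f\<in>F'. e \<noteq> f \<longrightarrow> fst e = fst f \<or> snd e = snd f \<longrightarrow> c e \<noteq> c f"
      by (elim exE conjE) (rule that)
    define c' where "c' e = (if e \<in> M then x else c e)" for e
    show ?thesis
    proof (intro exI[of _ c'] conjI ballI impI)
      fix e assume "e \<in> F"
      then show "c' e \<in> L e" using c(1) M(1) by (cases "e \<in> M") (auto simp: c'_def F'_def Fx_def)
    next
      fix e f assume ef: "e \<in> F" "f \<in> F" "e \<noteq> f" "fst e = fst f \<or> snd e = snd f"
      then show "c' e \<noteq> c' f"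
        using c M(2) by (cases "e \<in> M"; cases "f \<in> M") (auto simp: c'_def F'_def simp del: split_paired_All)
    qed
  qed simp
qed

section \<open>Koenig's theorem and list colouring with prescribed degrees\<close>

text \<open>The new edge can be coloured after exchanging two colours along a Kempe chain.\<close>
lemma koenig_edge_coloring:
  fixes F :: "('a \<times> 'b) set" and n :: nat
  assumes "finite F"
    and "\<And>a. card {e\<in>F. fst e = a} \<le> n" and "\<And>b. card {e\<in>F. snd e = b} \<le> n"
  shows "\<exists>c. (\<forall>e\<in>F. c e < n) \<and>
    (\<forall>e\<in>F. \<forall>f\<in>F. e \<noteq> f \<longrightarrow> fst e = fst f \<or> snd e = snd f \<longrightarrow> c e \<noteq> c f)"
  using assms
proof (induction F rule: finite_induct)
  case (insert e0 F)
  obtain a0 b0 where e0: "e0 = (a0, b0)" by (cases e0)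
  have deg: "card {e\<in>F. fst e = a} \<le> n" "card {e\<in>F. snd e = b} \<le> n" for a b
    by (rule order_trans[OF card_mono insert.prems(1)[of a]], use insert.hyps(1) in auto)
      (rule order_trans[OF card_mono insert.prems(2)[of b]], use insert.hyps(1) in auto)
  from insert.IH[OF this] obtain c where c': "\<forall>e\<in>F. c e < n"
    "\<forall>e\<in>F. \<forall>f\<in>F. e \<noteq> f \<longrightarrow> fst e = fst f \<or> snd e = snd f \<longrightarrow> c e \<noteq> c f"
    by (elim exE conjE) (rule that)
  have c: "e \<in> F \<Longrightarrow> c e < n"
    "e \<in> F \<Longrightarrow> f \<in> F \<Longrightarrow> e \<noteq> f \<Longrightarrow> fst e = fst f \<or> snd e = snd f \<Longrightarrow> c e \<noteq> c f" for e f
    using c' by blast+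
  \<comment> \<open>The new edge occupies one place at each of its ends, so some colour is free at
    \<open>a0\<close> and some colour at \<open>b0\<close>.\<close>
  have missing: "\<exists>\<alpha><n. \<forall>e\<in>S. c e \<noteq> \<alpha>" if "card (insert e0 S) \<le> n" "e0 \<notin> S" "finite S" for S
  proof -
    have "card (c ` S) < card {..<n}"
      using that card_image_le[of S c] by simp
    then have "\<not> {..<n} \<subseteq> c ` S"
      using card_mono that(3) by (metis finite_imageI not_le)
    then show ?thesis by blast
  qed
  have "{e \<in> insert e0 F. fst e = a0} = insert e0 {e \<in> F. fst e = a0}"
    "{e \<in> insert e0 F. snd e = b0} = insert e0 {e \<in> F. snd e = b0}" using e0 by auto
  then obtain \<alpha> \<beta> where \<alpha>: "\<alpha> < n" "\<And>e. e \<in> F \<Longrightarrow> fst e = a0 \<Longrightarrow> c e \<noteq> \<alpha>"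
    and \<beta>: "\<beta> < n" "\<And>e. e \<in> F \<Longrightarrow> snd e = b0 \<Longrightarrow> c e \<noteq> \<beta>"
    using missing[of "{e \<in> F. fst e = a0}"] missing[of "{e \<in> F. snd e = b0}"]
      insert.prems(1)[of a0] insert.prems(2)[of b0] insert.hyps by auto
  \<comment> \<open>The Kempe chain from \<open>a0\<close>, where \<alpha> is free: a step leaves a
    left vertex along \<beta> and returns along \<alpha>. \<open>R\<close> and \<open>RB\<close> are
    its left and right vertices, and no edge coloured \<alpha> or \<beta> joins the chain to its
    complement.\<close>
  define step where "step = {(x, z). \<exists>y. (x, y) \<in> F \<and> (z, y) \<in> F \<and> c (x, y) = \<beta> \<and> c (z, y) = \<alpha>}"
  define R where "R = step\<^sup>* `` {a0}"
  define sw where "sw i = (if i = \<alpha> then \<beta> else if i = \<beta> then \<alpha> else i)" for i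
  define RB where "RB = {y. \<exists>x\<in>R. (x, y) \<in> F \<and> c (x, y) = \<beta>}"
  have R0: "a0 \<in> R" by (simp add: R_def)
  have R_beta: "x \<in> R \<longleftrightarrow> y \<in> RB" if "(x, y) \<in> F" "c (x, y) = \<beta>" for x y
  proof
    assume "y \<in> RB"
    then obtain x' where "x' \<in> R" "(x', y) \<in> F" "c (x', y) = \<beta>" by (auto simp: RB_def)
    then show "x \<in> R" using c(2)[of "(x, y)" "(x', y)"] that by auto
  qed (use that in \<open>auto simp: RB_def\<close>)
  have R_alpha: "x \<in> R \<longleftrightarrow> y \<in> RB" if xy: "(x, y) \<in> F" "c (x, y) = \<alpha>" for x y
  proof
    assume "x \<in> R"
    then have "(a0, x) \<in> step\<^sup>*" by (simp add: R_def)
    then show "y \<in> RB"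
    proof (cases rule: rtranclE)
      case base
      then show ?thesis using \<alpha>(2)[of "(x, y)"] xy by auto
    next
      case (step x')
      then obtain y' where y': "(x', y') \<in> F" "(x, y') \<in> F" "c (x', y') = \<beta>" "c (x, y') = \<alpha>"
        by (auto simp: step_def)
      then have "y' = y" using c(2)[of "(x, y)" "(x, y')"] xy by auto
      then show ?thesis using y' step by (auto simp: RB_def R_def)
    qed
  next
    assume "y \<in> RB"
    then obtain x' where x': "x' \<in> R" "(x', y) \<in> F" "c (x', y) = \<beta>" by (auto simp: RB_def)
    then have "(x', x) \<in> step" using xy by (auto simp: step_def)
    then show "x \<in> R" using x'(1) unfolding R_def by (auto intro: rtrancl_into_rtrancl)
  qed
  \<comment> \<open>Every vertex of \<open>RB\<close> has an edge coloured \<beta> and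
    \<open>b0\<close> has none. So the exchange frees \<beta> at \<open>a0\<close> and leaves it
    free at \<open>b0\<close>.\<close>
  have b0: "b0 \<notin> RB" using \<beta>(2) by (force simp: RB_def)
  define c1 where "c1 e = (if fst e \<in> R \<and> c e \<in> {\<alpha>, \<beta>} then sw (c e) else c e)" for e
  \<comment> \<open>The exchange can be described from either end of an edge, so at each vertex it
    is one injective recolouring and stays proper.\<close>
  have c1_snd: "c1 e = (if snd e \<in> RB \<and> c e \<in> {\<alpha>, \<beta>} then sw (c e) else c e)" if "e \<in> F" for e
  proof -
    have "fst e \<in> R \<longleftrightarrow> snd e \<in> RB" if "c e \<in> {\<alpha>, \<beta>}"
      using R_alpha[of "fst e" "snd e"] R_beta[of "fst e" "snd e"] \<open>e \<in> F\<close> that unfolding prod.collapse by blast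
    then show ?thesis unfolding c1_def by presburger
  qed
  have sw_inj: "i = j" if "(if p \<and> i \<in> {\<alpha>, \<beta>} then sw i else i) = (if p \<and> j \<in> {\<alpha>, \<beta>} then sw j else j)" for i j p
    using that by (cases p) (auto simp: sw_def split: if_splits)
  have c1_proper: "c1 e \<noteq> c1 f" if "e \<in> F" "f \<in> F" "e \<noteq> f" "fst e = fst f \<or> snd e = snd f" for e f
  proof
    assume eq: "c1 e = c1 f"
    have "c e \<noteq> c f" using c(2) that by blast
    from that(4) show False
    proof
      assume "fst e = fst f"
      then show False using eq \<open>c e \<noteq> c f\<close> sw_inj[of "fst f \<in> R" "c e" "c f"] unfolding c1_def by simp
    next
      assume "snd e = snd f"
      then show False using eq \<open>c e \<noteq> c f\<close> sw_inj[of "snd f \<in> RB" "c e" "c f"]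
        unfolding c1_snd[OF that(1)] c1_snd[OF that(2)] by simp
    qed
  qed
  have c1_lt: "c1 e < n" if "e \<in> F" for e using c(1)[OF that] \<alpha>(1) \<beta>(1) by (auto simp: c1_def sw_def)
  have c1_a0: "c1 e \<noteq> \<beta>" if "e \<in> F" "fst e = a0" for e
    using \<alpha>(2)[OF that] R0 that by (auto simp: c1_def sw_def)
  have c1_b0: "c1 e \<noteq> \<beta>" if "e \<in> F" "snd e = b0" for e
    using \<beta>(2)[OF that] b0 that c1_snd[OF that(1)] by auto
  define c2 where "c2 = c1(e0 := \<beta>)"
  have new: "c2 e \<noteq> c2 e0" if "e \<in> F" "fst e = fst e0 \<or> snd e = snd e0" for e
    using that c1_a0[of e] c1_b0[of e] e0 insert.hyps(2) unfolding c2_def by (auto simp del: split_paired_All)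
  have old: "c2 e = c1 e" if "e \<in> F" for e
    using that insert.hyps(2) by (auto simp: c2_def)
  show ?case
  proof (intro exI[of _ c2] conjI ballI impI)
    fix e assume "e \<in> insert e0 F"
    then show "c2 e < n" using c1_lt[of e] \<beta>(1) by (auto simp: c2_def)
  next
    fix e f assume "e \<in> insert e0 F" "f \<in> insert e0 F" "e \<noteq> f" "fst e = fst f \<or> snd e = snd f"
    then show "c2 e \<noteq> c2 f"
      using c1_proper[of e f] new[of e] new[of f] old by (metis insertE)
  qed
qed simp

lemma extend_inj_on:
  fixes c :: "'a \<Rightarrow> nat"
  assumes "finite S" "T \<subseteq> S" "inj_on c T" "\<And>x. x \<in> T \<Longrightarrow> c x < n" "card S \<le> n"
  shows "\<exists>d. inj_on d S \<and> (\<forall>x\<in>S. d x < n) \<and> (\<forall>x\<in>T. d x = c x)"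
proof -
  have fT: "finite T" using assms finite_subset by blast
  have "card (c ` T) = card T" using assms(3) by (rule card_image)
  then have "card ({..<n} - c ` T) = n - card T"
    using assms(4) fT by (subst card_Diff_subset) auto
  moreover have "card (S - T) = card S - card T" using assms(2) fT by (simp add: card_Diff_subset)
  ultimately obtain h where h: "h ` (S - T) \<subseteq> {..<n} - c ` T" "inj_on h (S - T)"
    using card_le_inj[of "S - T" "{..<n} - c ` T"] assms(1,5) by (metis diff_le_mono finite_Diff finite_lessThan)
  show ?thesis
  proof (intro exI[of _ "\<lambda>x. if x \<in> T then c x else h x"] conjI)
    show "inj_on (\<lambda>x. if x \<in> T then c x else h x) S"
      using assms(2,3) h unfolding inj_on_def by (smt (verit) DiffD2 DiffI imageI subsetD)
  qed (use assms(4) h in auto)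
qed

text \<open>Choose \<open>i\<close> edges at every right vertex, edge-colour these with \<open>i\<close> colours and extend the
  colouring injectively at every left vertex. If left vertices prefer large colours and right
  vertices small ones, the numbers of preferred edges balance, since all \<open>i\<close> colours occur at
  each right vertex.\<close>
lemma bipartite_list_edge_coloring:
  fixes F :: "('a \<times> 'b) set" and L :: "'a \<times> 'b \<Rightarrow> 'c set"
  assumes fin: "finite F"
    and left: "\<And>a. card {e\<in>F. fst e = a} \<le> i"
    and right: "\<And>e. e \<in> F \<Longrightarrow> i \<le> card {f\<in>F. snd f = snd e}"
    and L: "\<And>e. e \<in> F \<Longrightarrow> finite (L e)" "\<And>e. e \<in> F \<Longrightarrow> card {f\<in>F. snd f = snd e} \<le> card (L e)"
  shows "\<exists>c. (\<forall>e\<in>F. c e \<in> L e) \<and>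
    (\<forall>e\<in>F. \<forall>f\<in>F. e \<noteq> f \<longrightarrow> fst e = fst f \<or> snd e = snd f \<longrightarrow> c e \<noteq> c f)"
proof -
  have "\<forall>b. \<exists>S. b \<in> snd ` F \<longrightarrow> S \<subseteq> {f\<in>F. snd f = b} \<and> card S = i \<and> finite S"
  proof
    fix b
    show "\<exists>S. b \<in> snd ` F \<longrightarrow> S \<subseteq> {f\<in>F. snd f = b} \<and> card S = i \<and> finite S"
    proof (cases "b \<in> snd ` F")
      case True
      then have "i \<le> card {f\<in>F. snd f = b}" using right by auto
      then obtain S where "S \<subseteq> {f\<in>F. snd f = b}" "card S = i" "finite S"
        by (rule obtain_subset_with_card_n)
      then show ?thesis by blast
    qed simp
  qed
  then obtain S where S': "\<forall>b. b \<in> snd ` F \<longrightarrow> S b \<subseteq> {f\<in>F. snd f = b} \<and> card (S b) = i \<and> finite (S b)"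
    unfolding choice_iff by (elim exE) (rule that)
  have S: "S b \<subseteq> {f\<in>F. snd f = b}" "card (S b) = i" "finite (S b)" if "b \<in> snd ` F" for b
    using S'[rule_format, OF that] by simp_all
  define F0 where "F0 = (\<Union>b\<in>snd ` F. S b)"
  have F0: "F0 \<subseteq> F" using S(1) by (auto simp: F0_def)
  then have "finite F0" using fin finite_subset by blast
  moreover have "card {e\<in>F0. fst e = a} \<le> i" for a
    by (rule order_trans[OF card_mono left[of a]]) (use fin F0 in auto)
  moreover have "card {e\<in>F0. snd e = b} \<le> i" for b
  proof (cases "b \<in> snd ` F")
    case True
    have "{e\<in>F0. snd e = b} \<subseteq> S b"
    proof
      fix e assume e: "e \<in> {e\<in>F0. snd e = b}"
      then obtain b' where b': "b' \<in> snd ` F" "e \<in> S b'" by (auto simp: F0_def simp del: split_paired_Ex)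
      then show "e \<in> S b" using S(1)[of b'] e by auto
    qed
    then show ?thesis using card_mono S(2,3)[OF True] by metis
  next
    case False
    then have "{e\<in>F0. snd e = b} = {}" using F0 by blast
    show ?thesis unfolding \<open>{e\<in>F0. snd e = b} = {}\<close> by simp
  qed
  ultimately have "\<exists>c. (\<forall>e\<in>F0. c e < i) \<and>
    (\<forall>e\<in>F0. \<forall>f\<in>F0. e \<noteq> f \<longrightarrow> fst e = fst f \<or> snd e = snd f \<longrightarrow> c e \<noteq> c f)"
    by (rule koenig_edge_coloring)
  then obtain c0 where c0': "\<forall>e\<in>F0. c0 e < i"
    "\<forall>e\<in>F0. \<forall>f\<in>F0. e \<noteq> f \<longrightarrow> fst e = fst f \<or> snd e = snd f \<longrightarrow> c0 e \<noteq> c0 f"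
    by (elim exE conjE) (rule that)
  have c0: "e \<in> F0 \<Longrightarrow> c0 e < i"
    "e \<in> F0 \<Longrightarrow> f \<in> F0 \<Longrightarrow> e \<noteq> f \<Longrightarrow> fst e = fst f \<or> snd e = snd f \<Longrightarrow> c0 e \<noteq> c0 f" for e f
    using c0' by blast+
  have "\<forall>a. \<exists>d. inj_on d {e\<in>F. fst e = a} \<and> (\<forall>e\<in>{e\<in>F. fst e = a}. d e < i) \<and>
    (\<forall>e\<in>{e\<in>F0. fst e = a}. d e = c0 e)"
  proof (intro allI extend_inj_on)
    fix a
    show "inj_on c0 {e\<in>F0. fst e = a}"
      by (rule inj_onI, rule ccontr) (use c0(2) in auto)
  qed (use fin F0 c0(1) left in auto)
  then obtain d where d': "\<forall>a. inj_on (d a) {e\<in>F. fst e = a} \<and> (\<forall>e\<in>{e\<in>F. fst e = a}. d a e < i) \<and>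
    (\<forall>e\<in>{e\<in>F0. fst e = a}. d a e = c0 e)"
    unfolding choice_iff by (elim exE) (rule that)
  have d: "inj_on (d a) {e\<in>F. fst e = a}"
    "\<And>e. e \<in> F \<Longrightarrow> fst e = a \<Longrightarrow> d a e < i" "\<And>e. e \<in> F0 \<Longrightarrow> fst e = a \<Longrightarrow> d a e = c0 e" for a
    using d'[rule_format, of a] by (simp_all del: split_paired_All)
  define q where "q e = d (fst e) e" for e
  have q_lt: "q e < i" if "e \<in> F" for e using d(2)[of e "fst e"] that by (simp add: q_def)
  have q_inj: "e = f" if "e \<in> F" "f \<in> F" "fst e = fst f" "q e = q f" for e f
    using inj_onD[OF d(1)[of "fst f"], of e f] that unfolding q_def by simp
  have q_S: "bij_betw q (S b) {..<i}" if b: "b \<in> snd ` F" for b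
  proof -
    have sub: "S b \<subseteq> F0" using b by (auto simp: F0_def)
    have eq: "q e = c0 e" if "e \<in> S b" for e using d(3)[of e "fst e"] sub that by (auto simp: q_def)
    have inj: "inj_on q (S b)"
    proof (rule inj_onI, rule ccontr)
      fix e f assume ef: "e \<in> S b" "f \<in> S b" "q e = q f" "e \<noteq> f"
      have "snd e = snd f" using S(1)[OF b] ef by auto
      then show False using c0(2)[of e f] ef sub eq by auto
    qed
    have "q ` S b \<subseteq> {..<i}" using q_lt sub F0 by blast
    moreover have "card (q ` S b) = card {..<i}" using card_image[OF inj] S(2)[OF b] by simp
    ultimately have "q ` S b = {..<i}" by (intro card_subset_eq) auto
    then show ?thesis using inj by (simp add: bij_betw_def)
  qed
  obtain idx where "bij_betw idx F {0..<card F}" using ex_bij_betw_finite_nat[OF fin] by blast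
  then have idx: "inj_on idx F" "\<And>e. e \<in> F \<Longrightarrow> idx e < card F"
    by (auto simp: bij_betw_def)
  \<comment> \<open>Lexicographic order by \<open>q\<close> and then by the index, because edges at
    a right vertex outside the chosen \<open>i\<close> may share a value of
    \<open>q\<close>.\<close>
  define rb where "rb e = q e * card F + idx e" for e
  have rb_q: "q f \<le> q e" if "e \<in> F" "rb f < rb e" for e f
  proof (rule ccontr)
    assume "\<not> q f \<le> q e"
    then have "(q e + 1) * card F \<le> q f * card F" by (intro mult_le_mono1) simp
    then show False using that idx(2)[of e] by (simp add: rb_def)
  qed
  have rb_inj: "e = f" if "e \<in> F" "f \<in> F" "snd e = snd f" "rb e = rb f" for e f
  proof -
    have "idx e = rb e mod card F" "idx f = rb f mod card F"
      using idx(2)[OF that(1)] idx(2)[OF that(2)] by (simp_all add: rb_def)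
    then show ?thesis using that inj_onD[OF idx(1), of e f] by simp
  qed
  show ?thesis
  proof (rule list_edge_coloring_of_preferences[OF fin _ rb_inj L(1)])
    fix e f assume ef: "e \<in> F" "f \<in> F" "fst e = fst f" "i - q e = i - q f"
    then have "q e = q f" using q_lt[of e] q_lt[of f] by linarith
    then show "e = f" by (rule q_inj[OF ef(1-3)])
  next
    fix e assume e: "e \<in> F"
    let ?b = "snd e"
    have b: "?b \<in> snd ` F" using e by blast
    let ?X = "{f\<in>F. snd f = ?b}"
    let ?Y = "{f\<in>F. snd f = ?b \<and> rb f < rb e}" and ?Z = "{f\<in>S ?b. q e < q f}"
    \<comment> \<open>At most i - 1 - q(e) edges are preferred at the left vertex, and exactly that
      many chosen edges at the right vertex have larger \<open>q\<close>. Those form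
      \<open>?Z\<close>, disjoint from the preferred set \<open>?Y\<close> and from e, so the total
      stays below the degree of the right vertex.\<close>
    have "card {f\<in>F. fst f = fst e \<and> i - q f < i - q e} \<le> card {q e<..<i}"
    proof (rule card_inj_on_le)
      show "inj_on q {f\<in>F. fst f = fst e \<and> i - q f < i - q e}"
        by (intro inj_onI q_inj) auto
      show "q ` {f\<in>F. fst f = fst e \<and> i - q f < i - q e} \<subseteq> {q e<..<i}"
        using q_lt by auto
    qed simp
    moreover have "card ?Z = card {q e<..<i}"
    proof -
      have "q ` ?Z = {j \<in> q ` S ?b. q e < j}" by blast
      also have "\<dots> = {q e<..<i}"
        unfolding bij_betw_imp_surj_on[OF q_S[OF b]] by auto
      finally have "q ` ?Z = {q e<..<i}" .
      moreover have "inj_on q ?Z" using inj_on_subset[OF bij_betw_imp_inj_on[OF q_S[OF b]]] by simp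
      ultimately show ?thesis using card_image[of q ?Z] by simp
    qed
    moreover have "card ?Y + card ?Z < card ?X"
    proof -
      have fYZ: "finite ?Y" "finite ?Z" using fin S(3)[OF b] by auto
      have "?Y \<inter> ?Z = {}" using rb_q[OF e] by fastforce
      then have "card ?Y + card ?Z = card (?Y \<union> ?Z)" by (rule card_Un_disjoint[OF fYZ, symmetric])
      also have "\<dots> < card ?X"
      proof (rule psubset_card_mono)
        show "finite ?X" using fin by simp
        have "e \<in> ?X - (?Y \<union> ?Z)" using e by auto
        then show "?Y \<union> ?Z \<subset> ?X" using S(1)[OF b] by blast
      qed
      finally show ?thesis .
    qed
    ultimately show "card {f\<in>F. fst f = fst e \<and> i - q f < i - q e} + card ?Y < card (L e)"
      using L(2)[OF e] by linarith
  qed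
qed

section \<open>Extending total colourings\<close>

lemma fresh_color:
  assumes "finite S" "card S < k"
  obtains c where "c \<in> {1..k}" "c \<notin> S"
proof (cases "{1..k} \<subseteq> S")
  case True
  then have "card {1..k} \<le> card S" by (intro card_mono assms(1))
  then show thesis using assms(2) by simp
next
  case False
  then show thesis using that by blast
qed

lemma total_coloringD:
  assumes "total_coloring V E k cv ce"
  shows "v \<in> V \<Longrightarrow> cv v \<in> {1..k}" and "e \<in> E \<Longrightarrow> ce e \<in> {1..k}"
    and "{u, v} \<in> E \<Longrightarrow> cv u \<noteq> cv v"
    and "e \<in> E \<Longrightarrow> e' \<in> E \<Longrightarrow> e \<noteq> e' \<Longrightarrow> e \<inter> e' \<noteq> {} \<Longrightarrow> ce e \<noteq> ce e'"
    and "e \<in> E \<Longrightarrow> v \<in> e \<Longrightarrow> ce e \<noteq> cv v"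
  using assms unfolding total_coloring_def by simp_all

lemma degree_mono: "finite E \<Longrightarrow> E' \<subseteq> E \<Longrightarrow> degree E' v \<le> degree E v"
  unfolding degree_def by (intro card_mono) auto

text \<open>The colour of u is erased first. Then uv avoids at most d(u) + d(v) - 2 edge colours and
  the colour of v, after which u avoids d(u) neighbours, d(u) - 1 other edges and the new
  colour.\<close>

lemma total_coloring_add_edge:
  assumes E: "simple_graph V E" and uv: "{u, v} \<in> E"
    and col: "total_coloring V (E - {{u, v}}) k cv ce"
    and sum: "degree E u + degree E v < k" and u: "2 * degree E u < k"
  shows "\<exists>cu c. total_coloring V E k (cv(u := cu)) (ce({u, v} := c))"
proof -
  let ?uv = "{u, v}"
  let ?X = "{e\<in>E. u \<in> e} - {?uv}" and ?Y = "{e\<in>E. v \<in> e} - {?uv}"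
  have fE: "finite E" by (rule simple_graph_finite_edges[OF E])
  have mem: "u \<in> V" "v \<in> V" "u \<noteq> v" using simple_graph_edge_mem[OF E uv] by auto
  have X: "card ?X + 1 = degree E u" and Y: "card ?Y + 1 = degree E v"
    unfolding degree_def using uv fE card_Suc_Diff1[of "{e\<in>E. u \<in> e}" ?uv]
      card_Suc_Diff1[of "{e\<in>E. v \<in> e}" ?uv] by auto
  have fXY: "finite ?X" "finite ?Y" using fE by auto
  have "card (insert (cv v) (ce ` ?X \<union> ce ` ?Y)) \<le> Suc (card (ce ` ?X \<union> ce ` ?Y))"
    by (rule card_insert_le_m1) auto
  also have "card (ce ` ?X \<union> ce ` ?Y) \<le> card ?X + card ?Y"
    by (rule order_trans[OF card_Un_le add_mono[OF card_image_le card_image_le]]) (use fXY in auto)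
  finally have cardc: "card (insert (cv v) (ce ` ?X \<union> ce ` ?Y)) < k" using X Y sum by linarith
  have "finite (insert (cv v) (ce ` ?X \<union> ce ` ?Y))" using fXY by blast
  from this cardc obtain c where c: "c \<in> {1..k}" "c \<notin> insert (cv v) (ce ` ?X \<union> ce ` ?Y)"
    by (rule fresh_color)
  let ?N = "{w. {u, w} \<in> E}"
  have fN: "finite ?N" by (rule simple_graph_finite_nbrs[OF E])
  have "card (insert c (cv ` ?N \<union> ce ` ?X)) \<le> Suc (card (cv ` ?N \<union> ce ` ?X))"
    by (rule card_insert_le_m1) auto
  also have "card (cv ` ?N \<union> ce ` ?X) \<le> card ?N + card ?X"
    by (rule order_trans[OF card_Un_le add_mono[OF card_image_le card_image_le]]) (use fN fXY in auto)
  finally have cardu: "card (insert c (cv ` ?N \<union> ce ` ?X)) < k"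
    using X u unfolding simple_graph_degree[OF E, symmetric] by linarith
  have "finite (insert c (cv ` ?N \<union> ce ` ?X))" using fXY(1) fN by blast
  from this cardu obtain cu where cu: "cu \<in> {1..k}" "cu \<notin> insert c (cv ` ?N \<union> ce ` ?X)"
    by (rule fresh_color)
  have cuN: "cu \<noteq> cv w" if "{u, w} \<in> E" for w using cu(2) that by blast
  have cuX: "cu \<noteq> ce e" if "e \<in> E" "e \<noteq> ?uv" "u \<in> e" for e using cu(2) that by blast
  have cX: "c \<noteq> ce e" if "e \<in> E" "e \<noteq> ?uv" "e \<inter> ?uv \<noteq> {}" for e using c(2) that by blast
  note D = total_coloringD[OF col]
  have "total_coloring V E k (cv(u := cu)) (ce(?uv := c))"
    unfolding total_coloring_def
  proof (intro conjI ballI allI impI)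
    fix w assume "w \<in> V"
    then show "(cv(u := cu)) w \<in> {1..k}" using D(1) cu(1) by simp
  next
    fix e assume "e \<in> E"
    then show "(ce(?uv := c)) e \<in> {1..k}" using D(2) c(1) by simp
  next
    fix x y assume xy: "{x, y} \<in> E"
    then have "x \<noteq> y" "{y, x} \<in> E" using simple_graph_edge_mem[OF E xy] by (auto simp: insert_commute)
    show "(cv(u := cu)) x \<noteq> (cv(u := cu)) y"
    proof (cases "x = u \<or> y = u")
      case True
      then show ?thesis using cuN[of x] cuN[of y] xy \<open>{y, x} \<in> E\<close> \<open>x \<noteq> y\<close> by auto
    next
      case False
      then have "{x, y} \<in> E - {?uv}" using xy by (auto simp: doubleton_eq_iff)
      then show ?thesis using D(3) False by simp
    qed
  next
    fix e e' assume ee: "e \<in> E" "e' \<in> E" "e \<noteq> e' \<and> e \<inter> e' \<noteq> {}"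
    consider "e = ?uv" | "e' = ?uv" | "e \<noteq> ?uv" "e' \<noteq> ?uv" by blast
    then show "(ce(?uv := c)) e \<noteq> (ce(?uv := c)) e'"
    proof cases
      case 1
      then have "e' \<noteq> ?uv" "e' \<inter> ?uv \<noteq> {}" using ee(3) by (simp_all add: Int_commute eq_commute)
      then show ?thesis using 1 cX[OF ee(2)] by simp
    next
      case 2
      then have "e \<noteq> ?uv" "e \<inter> ?uv \<noteq> {}" using ee(3) by auto
      then show ?thesis using 2 cX[OF ee(1)] by (simp add: eq_commute)
    next
      case 3
      then show ?thesis using D(4)[of e e'] ee by simp
    qed
  next
    fix e w assume e: "e \<in> E" "w \<in> e"
    show "(ce(?uv := c)) e \<noteq> (cv(u := cu)) w"
    proof (cases "e = ?uv")
      case True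
      then have "w = u \<or> w = v" using e(2) by simp
      then show ?thesis using True c(2) cu(2) mem(3) by auto
    next
      case False
      then show ?thesis using D(5)[of e w] cuX[of e] e by auto
    qed
  qed
  then show ?thesis by blast
qed

text \<open>The vertices of \<open>A\<close> stay uncoloured while the edges between \<open>A\<close> and \<open>V - A\<close> are coloured
  from lists, so that only one end of each such edge restricts its list.\<close>
lemma total_coloring_add_independent_set:
  assumes E: "simple_graph V E" and A: "A \<subseteq> V"
    and indep: "\<And>u v. u \<in> A \<Longrightarrow> v \<in> A \<Longrightarrow> {u, v} \<notin> E"
    and small: "\<And>a. a \<in> A \<Longrightarrow> degree E a \<le> i" "2 * i < k"
    and large: "\<And>v. v \<in> V \<Longrightarrow> degree E v < k"
    and many: "\<And>a b. a \<in> A \<Longrightarrow> {a, b} \<in> E \<Longrightarrow> i \<le> card {a'\<in>A. {b, a'} \<in> E}"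
    and col: "total_coloring (V - A) {e\<in>E. e \<inter> A = {}} k cv ce"
  shows "\<exists>cv' ce'. total_coloring V E k cv' ce' \<and> (\<forall>v. v \<notin> A \<longrightarrow> cv' v = cv v) \<and>
    (\<forall>e. e \<inter> A = {} \<longrightarrow> ce' e = ce e)"
proof -
  have fE: "finite E" by (rule simple_graph_finite_edges[OF E])
  have fV: "finite V" by (rule simple_graph_finite[OF E])
  have fA: "finite A" using A fV by (rule finite_subset)
  define F where "F = {(a, b). a \<in> A \<and> {a, b} \<in> E}"
  have F_sub: "F \<subseteq> V \<times> V" using simple_graph_edge_mem[OF E] by (auto simp: F_def)
  have fF: "finite F" by (rule finite_subset[OF F_sub]) (simp add: fV)
  define m where "m b = card {a\<in>A. {b, a} \<in> E}" for b
  have snd_F: "card {f\<in>F. snd f = b} = m b" for b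
  proof -
    have "{f\<in>F. snd f = b} = (\<lambda>a. (a, b)) ` {a\<in>A. {b, a} \<in> E}"
      by (auto simp: F_def insert_commute)
    moreover have "inj_on (\<lambda>a. (a, b)) {a\<in>A. {b, a} \<in> E}" by (auto simp: inj_on_def)
    ultimately show ?thesis unfolding m_def by (simp add: card_image)
  qed
  have fst_F: "card {f\<in>F. fst f = a} \<le> i" for a
  proof (cases "a \<in> A")
    case True
    have "{f\<in>F. fst f = a} \<subseteq> Pair a ` {b. {a, b} \<in> E}" by (auto simp: F_def)
    then have "card {f\<in>F. fst f = a} \<le> card {b. {a, b} \<in> E}"
      by (intro surj_card_le simple_graph_finite_nbrs[OF E])
    then show ?thesis using small(1)[OF True] unfolding simple_graph_degree[OF E] by linarith
  next
    case False
    then have "{f\<in>F. fst f = a} = {}" by (auto simp: F_def)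
    then show ?thesis by (simp only: card.empty le0)
  qed
  define Old where "Old b = {e\<in>E. e \<inter> A = {} \<and> b \<in> e}" for b
  define L where "L f = {1..k} - insert (cv (snd f)) (ce ` Old (snd f))" for f :: "'a \<times> 'a"
  \<comment> \<open>The list at b loses one colour for b and at most one for each old edge at b.
    Since the edges to \<open>A\<close> and the old edges together number at most d(b) < k, enough
    colours remain.\<close>
  have L_card: "card {f\<in>F. snd f = snd f0} \<le> card (L f0)" if f0: "f0 \<in> F" for f0
  proof -
    obtain a b where ab: "f0 = (a, b)" "a \<in> A" "{a, b} \<in> E" using f0 by (auto simp: F_def)
    have b: "b \<in> V" "b \<notin> A" using simple_graph_edge_mem[OF E ab(3)] indep ab by auto
    have "(\<lambda>a. {b, a}) ` {a\<in>A. {b, a} \<in> E} \<union> Old b \<subseteq> {e\<in>E. b \<in> e}" by (auto simp: Old_def)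
    then have "card ((\<lambda>a. {b, a}) ` {a\<in>A. {b, a} \<in> E} \<union> Old b) \<le> degree E b"
      unfolding degree_def using fE by (intro card_mono) auto
    moreover have "card ((\<lambda>a. {b, a}) ` {a\<in>A. {b, a} \<in> E} \<union> Old b)
        = card ((\<lambda>a. {b, a}) ` {a\<in>A. {b, a} \<in> E}) + card (Old b)"
      using fE fA by (intro card_Un_disjoint) (auto simp: Old_def)
    moreover have "card ((\<lambda>a. {b, a}) ` {a\<in>A. {b, a} \<in> E}) = m b"
      unfolding m_def by (rule card_image) (auto simp: inj_on_def doubleton_eq_iff)
    ultimately have deg: "m b + card (Old b) \<le> degree E b" by linarith
    have fO: "finite (Old b)" using fE by (simp add: Old_def)
    have "card (insert (cv b) (ce ` Old b)) \<le> Suc (card (ce ` Old b))"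
      by (rule card_insert_le_m1) auto
    also have "card (ce ` Old b) \<le> card (Old b)" using fO by (rule card_image_le)
    finally have "card (insert (cv b) (ce ` Old b)) \<le> Suc (card (Old b))" by simp
    moreover have "card {1..k} - card (insert (cv b) (ce ` Old b)) \<le> card (L f0)"
      unfolding L_def ab(1) snd_conv using fO by (intro diff_card_le_card_Diff) auto
    ultimately have "m b \<le> card (L f0)" using deg large[OF b(1)] by simp
    then show ?thesis unfolding snd_F ab(1) snd_conv .
  qed
  have "\<exists>c. (\<forall>f\<in>F. c f \<in> L f) \<and>
    (\<forall>f\<in>F. \<forall>g\<in>F. f \<noteq> g \<longrightarrow> fst f = fst g \<or> snd f = snd g \<longrightarrow> c f \<noteq> c g)"
  proof (rule bipartite_list_edge_coloring[OF fF fst_F _ _ L_card])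
    fix f assume "f \<in> F"
    then obtain a b where ab: "f = (a, b)" "a \<in> A" "{a, b} \<in> E" by (auto simp: F_def)
    show "i \<le> card {g\<in>F. snd g = snd f}"
      using many[OF ab(2,3)] unfolding snd_F m_def ab(1) snd_conv .
    show "finite (L f)" by (simp add: L_def)
  qed
  then obtain c where c: "\<forall>f\<in>F. c f \<in> L f"
    "\<forall>f\<in>F. \<forall>g\<in>F. f \<noteq> g \<longrightarrow> fst f = fst g \<or> snd f = snd g \<longrightarrow> c f \<noteq> c g"
    by (elim exE conjE) (rule that)
  have cL: "c (a, b) \<in> {1..k}" "c (a, b) \<noteq> cv b"
    "\<And>e. e \<in> E \<Longrightarrow> e \<inter> A = {} \<Longrightarrow> b \<in> e \<Longrightarrow> c (a, b) \<noteq> ce e"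
    if "a \<in> A" "{a, b} \<in> E" for a b
  proof -
    have "(a, b) \<in> F" using that by (simp add: F_def)
    then have "c (a, b) \<in> L (a, b)" using c(1) by blast
    then show "c (a, b) \<in> {1..k}" "c (a, b) \<noteq> cv b"
      "\<And>e. e \<in> E \<Longrightarrow> e \<inter> A = {} \<Longrightarrow> b \<in> e \<Longrightarrow> c (a, b) \<noteq> ce e"
      by (auto simp: L_def Old_def)
  qed
  have cP: "c (a, b) \<noteq> c (a', b')"
    if "a \<in> A" "{a, b} \<in> E" "a' \<in> A" "{a', b'} \<in> E" "(a, b) \<noteq> (a', b')" "a = a' \<or> b = b'" for a b a' b'
  proof -
    have "(a, b) \<in> F" "(a', b') \<in> F" using that by (simp_all add: F_def)
    then show ?thesis using c(2) that(5,6) by (metis fst_conv snd_conv)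
  qed
  \<comment> \<open>As \<open>A\<close> is independent, an edge meeting \<open>A\<close> has exactly
    one orientation in \<open>F\<close>, so the description is unique.\<close>
  define ce' where "ce' e = (if e \<inter> A = {} then ce e else c (THE f. f \<in> F \<and> e = {fst f, snd f}))" for e
  have ce'_new: "ce' {a, b} = c (a, b)" if ab: "a \<in> A" "{a, b} \<in> E" for a b
  proof -
    have "b \<notin> A" using indep ab by blast
    have "(THE f. f \<in> F \<and> {a, b} = {fst f, snd f}) = (a, b)"
    proof (rule the_equality)
      show "(a, b) \<in> F \<and> {a, b} = {fst (a, b), snd (a, b)}" using ab by (simp add: F_def)
      fix f assume f: "f \<in> F \<and> {a, b} = {fst f, snd f}"
      then have "fst f \<in> A" by (auto simp: F_def)
      then have "fst f = a" "snd f = b" using f \<open>b \<notin> A\<close> by (auto simp: doubleton_eq_iff)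
      then show "f = (a, b)" by (simp add: prod_eq_iff)
    qed
    then show ?thesis using ab(1) by (simp add: ce'_def)
  qed
  have ce'_old: "ce' e = ce e" if "e \<inter> A = {}" for e using that by (simp add: ce'_def)
  have newE: "\<exists>a b. e = {a, b} \<and> a \<in> A \<and> b \<notin> A \<and> {a, b} \<in> E" if e: "e \<in> E" "e \<inter> A \<noteq> {}" for e
  proof -
    obtain a where a: "a \<in> e" "a \<in> A" using e(2) by blast
    obtain b where b: "e = {a, b}" using E e(1) a(1) by (rule simple_graph_edgeE)
    then have "b \<notin> A" using indep[OF a(2), of b] e(1) by blast
    then show ?thesis using a b e(1) by blast
  qed
  \<comment> \<open>Vertices of \<open>A\<close> come last: each sees at most \<open>i\<close>
    neighbours and \<open>i\<close> edges, and independence lets all of them choose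
    separately.\<close>
  have "\<forall>a. \<exists>x. a \<in> A \<longrightarrow> x \<in> {1..k} \<and> x \<notin> cv ` {b. {a, b} \<in> E} \<union> ce' ` {e\<in>E. a \<in> e}"
  proof
    fix a
    show "\<exists>x. a \<in> A \<longrightarrow> x \<in> {1..k} \<and> x \<notin> cv ` {b. {a, b} \<in> E} \<union> ce' ` {e\<in>E. a \<in> e}"
    proof (cases "a \<in> A")
      case True
      have fN: "finite {b. {a, b} \<in> E}" "finite {e\<in>E. a \<in> e}"
        using simple_graph_finite_nbrs[OF E] fE by auto
      have "card (cv ` {b. {a, b} \<in> E} \<union> ce' ` {e\<in>E. a \<in> e}) \<le> degree E a + degree E a"
        unfolding simple_graph_degree[OF E, of a, symmetric]
        by (rule order_trans[OF card_Un_le add_mono])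
          (use fN in \<open>auto simp: degree_def simple_graph_degree[OF E, unfolded degree_def] intro!: order_trans[OF card_image_le]\<close>)
      then have card: "card (cv ` {b. {a, b} \<in> E} \<union> ce' ` {e\<in>E. a \<in> e}) < k"
        using small(1)[OF True] small(2) by linarith
      have "finite (cv ` {b. {a, b} \<in> E} \<union> ce' ` {e\<in>E. a \<in> e})" using fN by simp
      from this card obtain c where "c \<in> {1..k}" "c \<notin> cv ` {b. {a, b} \<in> E} \<union> ce' ` {e\<in>E. a \<in> e}"
        by (rule fresh_color)
      then show ?thesis by (intro exI[of _ c] impI conjI)
    qed simp
  qed
  then obtain x where x: "\<forall>a. a \<in> A \<longrightarrow> x a \<in> {1..k} \<and> x a \<notin> cv ` {b. {a, b} \<in> E} \<union> ce' ` {e\<in>E. a \<in> e}"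
    unfolding choice_iff by (elim exE) (rule that)
  define cv' where "cv' v = (if v \<in> A then x v else cv v)" for v
  have xa: "x a \<in> {1..k}" "{a, b} \<in> E \<Longrightarrow> x a \<noteq> cv b" "e \<in> E \<Longrightarrow> a \<in> e \<Longrightarrow> x a \<noteq> ce' e"
    if "a \<in> A" for a b e
    using x that by auto
  note D = total_coloringD[OF col]
  have mixed: "ce' e \<noteq> ce' e'" if e: "e \<in> E" "e \<inter> A \<noteq> {}" and e': "e' \<in> E" "e' \<inter> A = {}"
    and ee: "e \<inter> e' \<noteq> {}" for e e'
  proof -
    obtain a b where ab: "e = {a, b}" "a \<in> A" "b \<notin> A" "{a, b} \<in> E" using newE[OF e] by blast
    then have "b \<in> e'" using ee e'(2) by auto
    then show ?thesis
      using cL(3)[OF ab(2,4) e'] ce'_new[OF ab(2,4)] ce'_old[OF e'(2)] ab(1) by simp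
  qed
  have "total_coloring V E k cv' ce'"
    unfolding total_coloring_def
  proof (intro conjI ballI allI impI)
    fix v assume "v \<in> V"
    then show "cv' v \<in> {1..k}" using D(1)[of v] xa(1)[of v] by (simp add: cv'_def)
  next
    fix e assume e: "e \<in> E"
    show "ce' e \<in> {1..k}"
    proof (cases "e \<inter> A = {}")
      case True
      then show ?thesis using D(2)[of e] e ce'_old by simp
    next
      case False
      then obtain a b where "e = {a, b}" "a \<in> A" "{a, b} \<in> E" using newE[OF e] by blast
      then show ?thesis using cL(1) ce'_new by simp
    qed
  next
    fix u v assume uv: "{u, v} \<in> E"
    then have vu: "{v, u} \<in> E" by (simp add: insert_commute)
    consider "u \<in> A" "v \<notin> A" | "v \<in> A" "u \<notin> A" | "u \<notin> A" "v \<notin> A" using indep uv by blast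
    then show "cv' u \<noteq> cv' v"
    proof cases
      case 1 then show ?thesis using xa(2)[OF _ uv] by (simp add: cv'_def)
    next
      case 2 then show ?thesis using xa(2)[OF _ vu] by (simp add: cv'_def eq_commute)
    next
      case 3 then show ?thesis using D(3)[of u v] uv by (simp add: cv'_def)
    qed
  next
    fix e e' assume ee: "e \<in> E" "e' \<in> E" "e \<noteq> e' \<and> e \<inter> e' \<noteq> {}"
    consider "e \<inter> A = {}" "e' \<inter> A = {}" | "e \<inter> A \<noteq> {}" "e' \<inter> A = {}"
      | "e \<inter> A = {}" "e' \<inter> A \<noteq> {}" | "e \<inter> A \<noteq> {}" "e' \<inter> A \<noteq> {}" by blast
    then show "ce' e \<noteq> ce' e'"
    proof cases
      case 1 then show ?thesis using D(4)[of e e'] ee ce'_old by simp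
    next
      case 2 then show ?thesis using mixed[of e e'] ee by blast
    next
      case 3 then show ?thesis using mixed[of e' e] ee by (metis Int_commute)
    next
      case 4
      obtain a b where ab: "e = {a, b}" "a \<in> A" "b \<notin> A" "{a, b} \<in> E" using newE[OF ee(1) 4(1)] by blast
      obtain a' b' where ab': "e' = {a', b'}" "a' \<in> A" "b' \<notin> A" "{a', b'} \<in> E" using newE[OF ee(2) 4(2)] by blast
      have "a = a' \<or> b = b'" using ee(3) ab ab' by auto
      moreover have "(a, b) \<noteq> (a', b')" using ee(3) ab(1) ab'(1) by auto
      ultimately show ?thesis
        using cP[OF ab(2,4) ab'(2,4)] ce'_new[OF ab(2,4)] ce'_new[OF ab'(2,4)] ab(1) ab'(1) by simp
    qed
  next
    fix e v assume e: "e \<in> E" "v \<in> e"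
    show "ce' e \<noteq> cv' v"
    proof (cases "v \<in> A")
      case True
      then show ?thesis using xa(3)[OF True e] by (simp add: cv'_def eq_commute)
    next
      case False
      show ?thesis
      proof (cases "e \<inter> A = {}")
        case True
        then show ?thesis using D(5)[of e v] e False ce'_old by (simp add: cv'_def)
      next
        case nempty: False
        then obtain a b where ab: "e = {a, b}" "a \<in> A" "{a, b} \<in> E" using newE[OF e(1)] by blast
        then have "v = b" using e(2) False by auto
        then show ?thesis using cL(2)[OF ab(2,3)] ce'_new[OF ab(2,3)] ab(1) False by (simp add: cv'_def)
      qed
    qed
  qed
  then show ?thesis using ce'_old by (intro exI[of _ cv'] exI[of _ ce']) (simp add: cv'_def)
qed

section \<open>The minimal counterexample and its degree count\<close>

text \<open>Remove b together with the at most m members of A related to it. Nothing left is related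
  to b, so later witnesses differ from b, and each of them pays for at most m elements.\<close>

lemma card_le_by_peeling:
  fixes R :: "'b \<Rightarrow> 'a \<Rightarrow> bool"
  assumes "finite A" "finite B"
    and "\<And>S. S \<subseteq> A \<Longrightarrow> S \<noteq> {} \<Longrightarrow> \<exists>b\<in>B. {a\<in>S. R b a} \<noteq> {} \<and> card {a\<in>S. R b a} \<le> m"
  shows "card A \<le> m * card B"
  using assms
proof (induction "card A" arbitrary: A B rule: less_induct)
  case (less A B)
  show ?case
  proof (cases "A = {}")
    case False
    then obtain b where b: "b \<in> B" "{a\<in>A. R b a} \<noteq> {}" "card {a\<in>A. R b a} \<le> m"
      using less.prems(3)[OF subset_refl] by blast
    let ?N = "{a\<in>A. R b a}"
    have "card (A - ?N) \<le> m * card (B - {b})"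
    proof (rule less.hyps)
      show "card (A - ?N) < card A" using b(2) less.prems(1) by (intro psubset_card_mono) auto
      fix S assume S: "S \<subseteq> A - ?N" "S \<noteq> {}"
      then have "S \<subseteq> A" by blast
      then obtain b' where b': "b' \<in> B" "{a\<in>S. R b' a} \<noteq> {}" "card {a\<in>S. R b' a} \<le> m"
        using less.prems(3) S(2) by blast
      moreover have "b' \<noteq> b" using b'(2) S(1) by blast
      ultimately show "\<exists>b'\<in>B - {b}. {a\<in>S. R b' a} \<noteq> {} \<and> card {a\<in>S. R b' a} \<le> m" by blast
    qed (use less.prems in auto)
    moreover have "card A = card ?N + card (A - ?N)"
      using less.prems(1) by (subst card_Un_disjoint[symmetric]) (auto intro: arg_cong[where f = card])
    moreover have "card B = Suc (card (B - {b}))"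
      using card_Suc_Diff1[OF less.prems(2) b(1)] by simp
    ultimately show ?thesis using b(3) by simp
  qed simp
qed

text \<open>Planarity enters only as sparseness of all subgraphs, and \<Delta> + t is replaced by a
  fixed k above all degrees. Both conditions pass to subgraphs, so induction on |V| + |E| works
  while H stays fixed.\<close>

lemma extend_total_coloring:
  assumes "simple_graph V E"
    and "\<And>V' E'. V' \<subseteq> V \<Longrightarrow> E' \<subseteq> E \<Longrightarrow> (\<And>e. e \<in> E' \<Longrightarrow> e \<subseteq> V') \<Longrightarrow> V' \<noteq> {} \<Longrightarrow>
      card E' < 3 * card V'"
    and "\<And>v. v \<in> V \<Longrightarrow> degree E v < k"
    and "28 \<le> k"
    and "subgraph VH EH V E"
    and "distance3_cliques VH EH V E"
    and "total_coloring VH EH k cvH ceH"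
  shows "\<exists>cv ce. total_coloring V E k cv ce \<and> (\<forall>v\<in>VH. cv v = cvH v) \<and> (\<forall>e\<in>EH. ce e = ceH e)"
  using assms
proof (induction "card V + card E" arbitrary: V E rule: less_induct)
  case (less V E)
  note E = less.prems(1) and sparse = less.prems(2) and deg = less.prems(3) and k = less.prems(4)
  note dist = less.prems(6) and colH = less.prems(7)
  have VH: "VH \<subseteq> V" and EH: "EH \<subseteq> E" and EHVH: "\<And>e. e \<in> EH \<Longrightarrow> e \<subseteq> VH"
    using less.prems(5) unfolding subgraph_def by simp_all
  have fV: "finite V" and fE: "finite E"
    by (rule simple_graph_finite[OF E], rule simple_graph_finite_edges[OF E])
  have induced: "{u, v} \<in> EH" if "u \<in> VH" "v \<in> VH" "{u, v} \<in> E" for u v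
    using dist that simple_graph_edge_mem[OF E that(3)] unfolding distance3_cliques_def by blast
  have common: "{u, v} \<in> EH" if "u \<in> VH" "v \<in> VH" "{w, u} \<in> E" "{w, v} \<in> E" "u \<noteq> v" for u v w
  proof -
    have "{u, w} \<in> E" using that(3) by (simp add: insert_commute)
    then show ?thesis using dist that unfolding distance3_cliques_def by blast
  qed
  have smaller: "\<exists>cv ce. total_coloring V' E' k cv ce \<and> (\<forall>v\<in>VH. cv v = cvH v) \<and> (\<forall>e\<in>EH. ce e = ceH e)"
    if lt: "card V' + card E' < card V + card E" and V': "V' \<subseteq> V" "VH \<subseteq> V'" and E': "E' \<subseteq> E" "EH \<subseteq> E'"
      "\<And>e. e \<in> E' \<Longrightarrow> e \<subseteq> V'" for V' E'
  proof (rule less.hyps[OF lt])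
    show "simple_graph V' E'" by (rule simple_graph_restrict[OF E V'(1) E'(1,3)])
    show "card E'' < 3 * card V''" if "V'' \<subseteq> V'" "E'' \<subseteq> E'" "\<And>e. e \<in> E'' \<Longrightarrow> e \<subseteq> V''" "V'' \<noteq> {}" for V'' E''
      using that V'(1) E'(1) by (intro sparse) auto
    show "degree E' v < k" if "v \<in> V'" for v
      using le_less_trans[OF degree_mono[OF fE E'(1)] deg] that V'(1) by blast
    show "subgraph VH EH V' E'" unfolding subgraph_def using V'(2) E'(2) EHVH by simp
    show "distance3_cliques VH EH V' E'"
      using dist subsetD[OF E'(1)] unfolding distance3_cliques_def by meson
  qed (rule k colH)+
  show ?case
  proof (rule ccontr)
    assume none: "\<not> ?thesis"
    \<comment> \<open>Otherwise uv could be deleted and added back by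
      \<open>total_coloring_add_edge\<close>. Recolouring u is allowed outside H and possible
      because 2 * 13 < 28.\<close>
    have heavy: "k \<le> degree E u + degree E v"
      if uv: "{u, v} \<in> E" and u: "u \<notin> VH" "degree E u \<le> 13" for u v
    proof (rule ccontr)
      assume light: "\<not> k \<le> degree E u + degree E v"
      have nEH: "{u, v} \<notin> EH" using EHVH u(1) by blast
      have "card (E - {{u, v}}) < card E" by (rule card_Diff1_less[OF fE uv])
      then obtain cv ce where col: "total_coloring V (E - {{u, v}}) k cv ce"
        and ext: "\<forall>v\<in>VH. cv v = cvH v" "\<forall>e\<in>EH. ce e = ceH e"
        using smaller[of V "E - {{u, v}}"] VH EH nEH simple_graph_edge_subset[OF E] by auto
      obtain cu c where "total_coloring V E k (cv(u := cu)) (ce({u, v} := c))"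
        using total_coloring_add_edge[OF E uv col] light u(2) k by auto
      moreover have "\<forall>w\<in>VH. (cv(u := cu)) w = cvH w" using ext(1) u(1) by auto
      moreover have "\<forall>e\<in>EH. (ce({u, v} := c)) e = ceH e" using ext(2) nEH by auto
      ultimately show False using none by blast
    qed
    \<comment> \<open>Otherwise S could be deleted and added back by the list colouring. It is
      independent by \<open>heavy\<close>, as 5 + 5 < 28.\<close>
    have rare: "\<exists>a\<in>S. \<exists>b. {a, b} \<in> E \<and> card {a'\<in>S. {b, a'} \<in> E} < i"
      if S: "S \<subseteq> V - VH" "S \<noteq> {}" "\<And>a. a \<in> S \<Longrightarrow> degree E a \<le> i" and i: "i \<le> 5" for S i
    proof (rule ccontr)
      assume many: "\<not> ?thesis"
      let ?E' = "{e\<in>E. e \<inter> S = {}}"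
      have sub: "e \<subseteq> V - S" if "e \<in> ?E'" for e
        using that simple_graph_edge_subset[OF E, of e] by blast
      have "card (V - S) < card V" using S(1,2) fV by (intro psubset_card_mono) auto
      moreover have "card ?E' \<le> card E" using fE by (intro card_mono) auto
      moreover have "EH \<subseteq> ?E'" using EH EHVH S(1) by blast
      ultimately have "\<exists>cv ce. total_coloring (V - S) ?E' k cv ce \<and> (\<forall>v\<in>VH. cv v = cvH v) \<and> (\<forall>e\<in>EH. ce e = ceH e)"
        using VH S(1) by (intro smaller[OF _ _ _ _ _ sub]) auto
      then obtain cv ce where col: "total_coloring (V - S) ?E' k cv ce"
        and ext: "\<forall>v\<in>VH. cv v = cvH v" "\<forall>e\<in>EH. ce e = ceH e" by blast
      have "\<exists>cv' ce'. total_coloring V E k cv' ce' \<and> (\<forall>v. v \<notin> S \<longrightarrow> cv' v = cv v) \<and>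
        (\<forall>e. e \<inter> S = {} \<longrightarrow> ce' e = ce e)"
      proof (rule total_coloring_add_independent_set[OF E _ _ _ _ deg _ col])
        show "S \<subseteq> V" using S(1) by blast
        show "{u, v} \<notin> E" if "u \<in> S" "v \<in> S" for u v
        proof
          assume "{u, v} \<in> E"
          moreover have "u \<notin> VH" using S(1) that(1) by blast
          ultimately have "k \<le> degree E u + degree E v"
            using S(3)[OF that(1)] i by (intro heavy) auto
          then show False using S(3)[OF that(1)] S(3)[OF that(2)] i k by linarith
        qed
        show "2 * i < k" using i k by linarith
        show "i \<le> card {a'\<in>S. {b, a'} \<in> E}" if "a \<in> S" "{a, b} \<in> E" for a b
          using many that not_less by blast
      qed (use S(3) in auto)
      then obtain cv' ce' where "total_coloring V E k cv' ce'"
        "\<forall>v. v \<notin> S \<longrightarrow> cv' v = cv v" "\<forall>e. e \<inter> S = {} \<longrightarrow> ce' e = ce e" by blast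
      moreover from this have "\<forall>v\<in>VH. cv' v = cvH v" using S(1) ext(1) by (metis DiffD2 subsetD)
      moreover have "\<forall>e\<in>EH. ce' e = ceH e"
        using calculation(3) ext(2) \<open>EH \<subseteq> ?E'\<close> by (metis (mono_tags, lifting) mem_Collect_eq subsetD)
      ultimately show False using none by blast
    qed
    define Light where "Light i = {v\<in>V - VH. degree E v \<le> i}" for i
    define B where "B = {b\<in>V. \<exists>a\<in>Light 5. {a, b} \<in> E}"
    define Hs where "Hs = {v\<in>VH. degree E v \<le> 12}"
    define V' where "V' = V - Hs"
    define E' where "E' = {e\<in>E. e \<inter> Hs = {}}"
    have fB: "finite B" using fV by (simp add: B_def)
    have fV': "finite V'" using fV by (simp add: V'_def)
    have Light_card: "card (Light i) \<le> (i - 1) * card B" if i: "i \<le> 5" for i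
    proof (rule card_le_by_peeling[where R = "\<lambda>b a. {b, a} \<in> E"])
      show "finite (Light i)" using fV by (simp add: Light_def)
      show "finite B" by (rule fB)
      fix S assume S: "S \<subseteq> Light i" "S \<noteq> {}"
      have "\<exists>a\<in>S. \<exists>b. {a, b} \<in> E \<and> card {a'\<in>S. {b, a'} \<in> E} < i"
        using S i by (intro rare) (auto simp: Light_def)
      then obtain a b where ab: "a \<in> S" "{a, b} \<in> E" "card {a'\<in>S. {b, a'} \<in> E} < i" by blast
      have "a \<in> Light 5" using ab(1) S(1) i unfolding Light_def by force
      then have "b \<in> B" using ab(2) simple_graph_edge_mem[OF E ab(2)] unfolding B_def by blast
      moreover have "a \<in> {a'\<in>S. {b, a'} \<in> E}" using ab by (simp add: insert_commute)
      ultimately show "\<exists>b\<in>B. {a'\<in>S. {b, a'} \<in> E} \<noteq> {} \<and> card {a'\<in>S. {b, a'} \<in> E} \<le> i - 1"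
        using ab(3) by (intro bexI[of _ b] conjI) auto
    qed
    have B_heavy: "23 \<le> degree E b" if "b \<in> B" for b
    proof -
      obtain a where a: "a \<in> Light 5" "{a, b} \<in> E" using \<open>b \<in> B\<close> by (auto simp: B_def)
      then have "k \<le> degree E a + degree E b" by (intro heavy) (auto simp: Light_def)
      then show ?thesis using a(1) k by (simp add: Light_def)
    qed
    have "V' \<noteq> {}"
    proof
      \<comment> \<open>Then G equals H, and the given colouring is itself the extension.\<close>
      assume "V' = {}"
      then have VVH: "V = VH" using VH by (auto simp: V'_def Hs_def)
      have "E \<subseteq> EH"
      proof
        fix e assume e: "e \<in> E"
        from E this obtain u v where "e = {u, v}" "u \<in> V" "v \<in> V" by (rule simple_graphE)
        then show "e \<in> EH" using induced e VVH by simp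
      qed
      then have "E = EH" using EH by blast
      then show False using none colH VVH by blast
    qed
    have E'_V': "e \<subseteq> V'" if "e \<in> E'" for e
      using that simple_graph_edge_subset[OF E, of e] by (auto simp: E'_def V'_def)
    have E': "simple_graph V' E'"
      by (rule simple_graph_restrict[OF E _ _ E'_V']) (auto simp: V'_def E'_def)
    have "card E' < 3 * card V'"
      using \<open>V' \<noteq> {}\<close> E'_V' by (intro sparse) (auto simp: V'_def E'_def)
    then have upper: "(\<Sum>v\<in>V'. degree E' v) < 6 * card V'" using sum_degree[OF E'] by simp
    \<comment> \<open>Neighbours of v in H share v, so they lie in one clique. A clique on s
      vertices with s(s - 1)/2 < 3s has s at most 6.\<close>
    have few_H: "card {u\<in>Hs. {v, u} \<in> E} \<le> 6" for v
    proof (cases "{u\<in>VH. {v, u} \<in> E} = {}")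
      case True
      then have "{u\<in>Hs. {v, u} \<in> E} = {}" by (auto simp: Hs_def)
      then show ?thesis by (simp only: card.empty le0)
    next
      case False
      let ?S = "{u\<in>VH. {v, u} \<in> E}"
      have fS: "finite ?S" using VH fV by (simp add: finite_subset)
      have "{e. e \<subseteq> ?S \<and> card e = 2} \<subseteq> E"
      proof
        fix e assume "e \<in> {e. e \<subseteq> ?S \<and> card e = 2}"
        then obtain u w where "e = {u, w}" "u \<noteq> w" "u \<in> ?S" "w \<in> ?S" by (auto simp: card_2_iff)
        then show "e \<in> E" using common EH by blast
      qed
      then have "card {e. e \<subseteq> ?S \<and> card e = 2} < 3 * card ?S"
        using False VH by (intro sparse) auto
      then have "card ?S * (card ?S - 1) div 2 < 3 * card ?S"
        unfolding n_subsets[OF fS] choose_two .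
      have "card ?S \<le> 6"
      proof (rule ccontr)
        assume "\<not> card ?S \<le> 6"
        then have "card ?S * 6 \<le> card ?S * (card ?S - 1)" by (intro mult_le_mono2) linarith
        then have "3 * card ?S \<le> card ?S * (card ?S - 1) div 2" by linarith
        then show False using \<open>card ?S * (card ?S - 1) div 2 < 3 * card ?S\<close> by linarith
      qed
      moreover have "card {u\<in>Hs. {v, u} \<in> E} \<le> card ?S"
        using fS by (intro card_mono) (auto simp: Hs_def)
      ultimately show ?thesis by linarith
    qed
    have degree_E': "degree E v = degree E' v + card {u\<in>Hs. {v, u} \<in> E}" if v: "v \<in> V'" for v
    proof -
      have "{u. {v, u} \<in> E} = {u. {v, u} \<in> E'} \<union> {u\<in>Hs. {v, u} \<in> E}"
        using v by (auto simp: E'_def V'_def)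
      moreover have "{u. {v, u} \<in> E'} \<inter> {u\<in>Hs. {v, u} \<in> E} = {}" by (auto simp: E'_def)
      moreover have "finite {u\<in>Hs. {v, u} \<in> E}"
        by (rule finite_subset[OF _ simple_graph_finite_nbrs[OF E, of v]]) auto
      ultimately show ?thesis
        unfolding simple_graph_degree[OF E] simple_graph_degree[OF E']
        using card_Un_disjoint[OF simple_graph_finite_nbrs[OF E']] by simp
    qed
    have Light_V': "Light i \<subseteq> V'" for i by (auto simp: Light_def V'_def Hs_def)
    have B_V': "B \<subseteq> V'" using B_heavy by (force simp: B_def V'_def Hs_def)
    \<comment> \<open>The bound (i - 1)|B| is zero for i = 1. This excludes degree 0, whose deficit
      of 6 the five sets \<open>Light i\<close> could not cover.\<close>
    have no_Light_1: "Light 1 = {}"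
      using Light_card[of 1] finite_subset[OF Light_V' fV'] by simp
    \<comment> \<open>A light vertex of degree j lies in 6 - j of the sets \<open>Light i\<close>,
      which is its deficit. A vertex of \<open>B\<close> keeps at least 23 - 6 = 17 neighbours, any
      other vertex of H at least 13 - 6, and a vertex outside H of degree at least 14 keeps
      8.\<close>
    have local: "6 + 10 * of_bool (v \<in> B) \<le> degree E' v + (\<Sum>i=1..5. of_bool (v \<in> Light i))"
      if v: "v \<in> V'" for v
    proof -
      have six: "degree E v \<le> degree E' v + 6" using degree_E'[OF v] few_H[of v] by linarith
      have vV: "v \<in> V" using v by (simp add: V'_def)
      \<comment> \<open>A neighbour in \<open>Hs\<close> would give degree sum at most 13 + 12 < 28,
        against \<open>heavy\<close>.\<close>
      have untouched: "degree E' v = degree E v" if "v \<notin> VH" "degree E v \<le> 13"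
      proof -
        have "{u\<in>Hs. {v, u} \<in> E} = {}"
        proof (rule ccontr)
          assume "{u\<in>Hs. {v, u} \<in> E} \<noteq> {}"
          then obtain u where u: "u \<in> Hs" "{v, u} \<in> E" by blast
          then have "k \<le> degree E v + degree E u" using that by (intro heavy) auto
          then show False using that(2) u(1) k by (simp add: Hs_def)
        qed
        then show ?thesis using degree_E'[OF v] by (simp only: card.empty)
      qed
      consider "v \<in> B" | "v \<notin> B" "v \<in> VH" | "v \<notin> B" "v \<notin> VH" "degree E v \<ge> 14"
        | "v \<notin> B" "v \<notin> VH" "6 \<le> degree E v" "degree E v \<le> 13" | "v \<notin> VH" "degree E v \<le> 5"
        by linarith
      then show ?thesis
      proof cases
        case 1
        then show ?thesis using B_heavy[OF 1] six by simp
      next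
        case 2
        then have "13 \<le> degree E v" using v by (simp add: V'_def Hs_def)
        then show ?thesis using six 2 by simp
      next
        case 3
        then show ?thesis using six by simp
      next
        case 4
        then show ?thesis using untouched by simp
      next
        case 5
        have "v \<notin> B" using B_heavy 5(2) by fastforce
        have L: "v \<in> Light i \<longleftrightarrow> degree E v \<le> i" for i using 5 vV by (simp add: Light_def)
        have "1 < degree E v" using no_Light_1 L[of 1] by auto
        then have "degree E v = 2 \<or> degree E v = 3 \<or> degree E v = 4 \<or> degree E v = 5"
          using 5(2) by linarith
        then show ?thesis
          using \<open>v \<notin> B\<close> untouched 5 unfolding L by (auto simp: numeral_eq_Suc)
      qed
    qed
    have count: "(\<Sum>v\<in>V'. of_bool (v \<in> X)) = card X" if "X \<subseteq> V'" for X
      using that fV' by (simp add: Int_absorb1)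
    \<comment> \<open>Summing \<open>local\<close>, the deficits cost at most (0 + 1 + 2 + 3 +
      4)|B|, which the excess of 10 at each vertex of \<open>B\<close> pays exactly.\<close>
    have "6 * card V' + 10 * card B = (\<Sum>v\<in>V'. 6 + 10 * of_bool (v \<in> B))"
      unfolding sum.distrib sum_distrib_left[symmetric] count[OF B_V'] by simp
    also have "\<dots> \<le> (\<Sum>v\<in>V'. degree E' v + (\<Sum>i=1..5. of_bool (v \<in> Light i)))"
      by (rule sum_mono) (rule local)
    also have "\<dots> = (\<Sum>v\<in>V'. degree E' v) + (\<Sum>i=1..5. card (Light i))"
      unfolding sum.distrib by (subst sum.swap) (simp only: count[OF Light_V'])
    also have "(\<Sum>i=1..5. card (Light i)) \<le> (\<Sum>i=1..5. (i - 1) * card B)"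
      by (intro sum_mono Light_card) simp
    also have "(\<Sum>i=1..5. (i - 1) * card B) = 10 * card B"
      by (simp add: numeral_eq_Suc)
    finally show False using upper by linarith
  qed
qed

theorem theorem3p1:
  fixes V VH :: "'a set" and E EH :: "'a set set" and t :: nat
    and cvH :: "'a \<Rightarrow> nat" and ceH :: "'a set \<Rightarrow> nat"
  assumes "1 \<le> t" and "t \<le> 4"
    and "planar_graph V E"
    and "max_degree V E \<ge> 28 - t"
    and "subgraph VH EH V E"
    and "distance3_cliques VH EH V E"
    and "total_coloring VH EH (max_degree V E + t) cvH ceH"
  shows "\<exists>cv ce. total_coloring V E (max_degree V E + t) cv ce \<and>
           (\<forall>v\<in>VH. cv v = cvH v) \<and> (\<forall>e\<in>EH. ce e = ceH e)"
proof (rule extend_total_coloring)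
  show E: "simple_graph V E" using assms(3) by (simp add: planar_graph_def)
  show "card E' < 3 * card V'"
    if "V' \<subseteq> V" "E' \<subseteq> E" "\<And>e. e \<in> E' \<Longrightarrow> e \<subseteq> V'" "V' \<noteq> {}" for V' E'
    by (rule planar_graph_sparse[OF assms(3) that])
  show "degree E v < max_degree V E + t" if "v \<in> V" for v
  proof -
    have "degree E v \<le> max_degree V E"
      unfolding max_degree_def using that simple_graph_finite[OF E] by (intro Max_ge) auto
    then show ?thesis using assms(1) by linarith
  qed
  show "28 \<le> max_degree V E + t" using assms(4) by linarith
qed (rule assms)+

end
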